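(* Let $G$ be a locally compact, Hausdorff, étale groupoid with compact unit space, and assume that there exists a Kazhdan projection $p\in C^*_r(G)$. Let $E:C^*_r(G)\to C(G^{(0)})$ be the canonical conditional expectation. Then $$\{x\in G^{(0)}\mid E(p)(x)>0\}=\{x\in G^{(0)}\mid G_x\text{ is finite}\}.$$ In particular, if a Kazhdan projection $p$ exists in $C^*_r(G)$, then it is non-zero if and only if the source fibre $G_x$ is finite for some $x\in G^{(0)}$.
   Context: Notation: $r,s$ are the range and source maps, $G^x=r^{-1}(x)$, $G_x=s^{-1}(x)$. Étale means the topology has a basis of open bisections (open sets on which $r$ and $s$ are homeomorphisms onto their images in $G^{(0)}$). $C_c(G)$ is the convolution $*$-algebra, $(f_1f_2)(g)=\sum_{hk=g}f_1(h)f_2(k)$, $f^*(g)=\overline{f(g^{-1})}$. For $x\in G^{(0)}$ the regular representation $\pi_x$ of $C_c(G)$ on $\ell^2(G_x)$ is $(\pi_x(f)\xi)(g)=\sum_{h\in G_x}f(gh^{-1})\xi(h)$. $C^*_r(G)$ is the completion of $C_c(G)$ for the norm $\sup_x\|\pi_x(f)\|$. The canonical conditional expectation $E:C^*_r(G)\to C(G^{(0)})$ is the faithful one extending restriction of functions $C_c(G)\to C(G^{(0)})$; it satisfies $E(a)(x)=\langle\delta_x,\pi_x(a)\delta_x\rangle$. Put $\Psi:C_c(G)\to C(G^{(0)})$, $\Psi(f)(x)=\sum_{g\in G^x}f(g)$. In a unital $*$-representation $(H,\pi)$ of $C_c(G)$, a vector $\xi$ is constant if $\pi(f)\xi=\pi(\Psi(f))\xi$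 for all $f\in C_c(G)$. A Kazhdan projection in $C^*_r(G)$ is a projection $p$ whose image in every (unital) $*$-representation of $C^*_r(G)$ is the orthogonal projection onto the constant vectors (for the restriction of the representation to $C_c(G)$). *)

theory Defs
  imports
    "HOL-Algebra.Module"
    "HOL-Analysis.Analysis"
    "HOL-Library.Complex_Order"
begin

section \<open>Etale groupoids\<close>

record 'g groupoid =
  gtop :: "'g topology"
  rng :: "'g \<Rightarrow> 'g"
  src :: "'g \<Rightarrow> 'g"
  gmult :: "'g \<Rightarrow> 'g \<Rightarrow> 'g"
  ginv :: "'g \<Rightarrow> 'g"

text \<open>The underlying set of the groupoid is the carrier of its topology; units are identified
  with their identity arrows, so the unit space is the common image of the range and source maps.\<close>

definition arrows :: "'g groupoid \<Rightarrow> 'g set" where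
  "arrows G = topspace (gtop G)"

definition units :: "'g groupoid \<Rightarrow> 'g set" where
  "units G = rng G ` arrows G"

definition composable :: "'g groupoid \<Rightarrow> ('g \<times> 'g) set" where
  "composable G = {(g, h). g \<in> arrows G \<and> h \<in> arrows G \<and> src G g = rng G h}"

definition src_fibre :: "'g groupoid \<Rightarrow> 'g \<Rightarrow> 'g set" where
  "src_fibre G x = {g \<in> arrows G. src G g = x}"

definition rng_fibre :: "'g groupoid \<Rightarrow> 'g \<Rightarrow> 'g set" where
  "rng_fibre G x = {g \<in> arrows G. rng G g = x}"

locale topological_groupoid =
  fixes G :: "'g groupoid"
  assumes rng_closed: "g \<in> arrows G \<Longrightarrow> rng G g \<in> arrows G"
    and src_closed: "g \<in> arrows G \<Longrightarrow> src G g \<in> arrows G"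
    and rng_rng: "g \<in> arrows G \<Longrightarrow> rng G (rng G g) = rng G g"
    and src_rng: "g \<in> arrows G \<Longrightarrow> src G (rng G g) = rng G g"
    and rng_src: "g \<in> arrows G \<Longrightarrow> rng G (src G g) = src G g"
    and src_src: "g \<in> arrows G \<Longrightarrow> src G (src G g) = src G g"
    and gmult_closed: "(g, h) \<in> composable G \<Longrightarrow> gmult G g h \<in> arrows G"
    and rng_gmult: "(g, h) \<in> composable G \<Longrightarrow> rng G (gmult G g h) = rng G g"
    and src_gmult: "(g, h) \<in> composable G \<Longrightarrow> src G (gmult G g h) = src G h"
    and gmult_assoc: "(g, h) \<in> composable G \<Longrightarrow> (h, k) \<in> composable G \<Longrightarrow>
          gmult G (gmult G g h) k = gmult G g (gmult G h k)"
    and rng_unit: "g \<in> arrows G \<Longrightarrow> gmult G (rng G g) g = g"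
    and src_unit: "g \<in> arrows G \<Longrightarrow> gmult G g (src G g) = g"
    and ginv_closed: "g \<in> arrows G \<Longrightarrow> ginv G g \<in> arrows G"
    and rng_ginv: "g \<in> arrows G \<Longrightarrow> rng G (ginv G g) = src G g"
    and src_ginv: "g \<in> arrows G \<Longrightarrow> src G (ginv G g) = rng G g"
    and gmult_ginv: "g \<in> arrows G \<Longrightarrow> gmult G g (ginv G g) = rng G g"
    and ginv_gmult: "g \<in> arrows G \<Longrightarrow> gmult G (ginv G g) g = src G g"
    and continuous_gmult:
      "continuous_map (subtopology (prod_topology (gtop G) (gtop G)) (composable G)) (gtop G)
         (\<lambda>(g, h). gmult G g h)"
    and continuous_ginv: "continuous_map (gtop G) (gtop G) (ginv G)"

definition open_bisection :: "'g groupoid \<Rightarrow> 'g set \<Rightarrow> bool" where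
  "open_bisection G U \<longleftrightarrow> openin (gtop G) U \<and>
     homeomorphic_map (subtopology (gtop G) U) (subtopology (gtop G) (rng G ` U)) (rng G) \<and>
     homeomorphic_map (subtopology (gtop G) U) (subtopology (gtop G) (src G ` U)) (src G)"

text \<open>The images of open bisections are not required to be open in the unit space. This is usually
  part of the meaning of ``etale''; leaving it out only enlarges the class of groupoids.\<close>

locale etale_groupoid = topological_groupoid +
  assumes bisection_basis: "openin (gtop G) W \<Longrightarrow> g \<in> W \<Longrightarrow>
    \<exists>U. open_bisection G U \<and> g \<in> U \<and> U \<subseteq> W"

definition Cc :: "'g groupoid \<Rightarrow> ('g \<Rightarrow> complex) set" where
  "Cc G = {f. continuous_map (gtop G) euclidean f \<and> (\<forall>g. g \<notin> arrows G \<longrightarrow> f g = 0) \<and>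
     compactin (gtop G) (gtop G closure_of {g \<in> arrows G. f g \<noteq> 0})}"

text \<open>For a Hausdorff etale groupoid with compact unit space, the unit space is open and closed;
  functions on it are extended by zero, which embeds \<open>C_units G\<close> into \<open>Cc G\<close>.\<close>

definition C_units :: "'g groupoid \<Rightarrow> ('g \<Rightarrow> complex) set" where
  "C_units G = {\<phi>. continuous_map (subtopology (gtop G) (units G)) euclidean \<phi> \<and>
     (\<forall>g. g \<notin> units G \<longrightarrow> \<phi> g = 0)}"

text \<open>The sum is finite for \<open>f \<in> Cc G\<close>: range fibres are closed and discrete.\<close>

definition Psi :: "'g groupoid \<Rightarrow> ('g \<Rightarrow> complex) \<Rightarrow> 'g \<Rightarrow> complex" where
  "Psi G f = (\<lambda>x. if x \<in> units G then \<Sum>\<^sub>\<infinity>g\<in>rng_fibre G x. f g else 0)"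


section \<open>Complex Hilbert spaces and normed *-algebras\<close>

definition complex_ring :: "complex ring" where
  "complex_ring = \<lparr>carrier = UNIV, monoid.mult = (*), one = 1, zero = 0, add = (+)\<rparr>"

text \<open>As usual for modules in HOL-Algebra, the fields \<open>mult\<close> and \<open>one\<close> of the record carry no
  meaning for Hilbert spaces.\<close>

record 'h hilb = "(complex, 'h) module" +
  cip :: "'h \<Rightarrow> 'h \<Rightarrow> complex"

definition hnorm :: "'h hilb \<Rightarrow> 'h \<Rightarrow> real" where
  "hnorm H \<xi> = sqrt (Re (cip H \<xi> \<xi>))"

locale hilbert_space = Module.module complex_ring H for H :: "'h hilb" (structure) +
  assumes cip_add: "\<xi> \<in> carrier H \<Longrightarrow> \<eta> \<in> carrier H \<Longrightarrow> \<zeta> \<in> carrier H \<Longrightarrow>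
      cip H \<xi> (\<eta> \<oplus> \<zeta>) = cip H \<xi> \<eta> + cip H \<xi> \<zeta>"
    and cip_smult: "\<xi> \<in> carrier H \<Longrightarrow> \<eta> \<in> carrier H \<Longrightarrow> cip H \<xi> (c \<odot> \<eta>) = c * cip H \<xi> \<eta>"
    and cip_commute: "\<xi> \<in> carrier H \<Longrightarrow> \<eta> \<in> carrier H \<Longrightarrow> cip H \<eta> \<xi> = cnj (cip H \<xi> \<eta>)"
    and cip_pos: "\<xi> \<in> carrier H \<Longrightarrow> \<xi> \<noteq> \<zero> \<Longrightarrow> 0 < cip H \<xi> \<xi>"
    and complete: "Metric_space.mcomplete (carrier H) (\<lambda>\<xi> \<eta>. hnorm H (\<xi> \<ominus> \<eta>))"

record 'a normed_star_alg = "(complex, 'a) module" +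
  star :: "'a \<Rightarrow> 'a"
  anorm :: "'a \<Rightarrow> real"

definition unital_star_hom ::
  "('a, 'm) normed_star_alg_scheme \<Rightarrow> ('b, 'n) normed_star_alg_scheme \<Rightarrow> ('a \<Rightarrow> 'b) \<Rightarrow> bool" where
  "unital_star_hom A B \<pi> \<longleftrightarrow>
     \<pi> \<in> carrier A \<rightarrow> carrier B \<and>
     (\<forall>a\<in>carrier A. \<forall>b\<in>carrier A. \<pi> (a \<oplus>\<^bsub>A\<^esub> b) = \<pi> a \<oplus>\<^bsub>B\<^esub> \<pi> b) \<and>
     (\<forall>c. \<forall>a\<in>carrier A. \<pi> (c \<odot>\<^bsub>A\<^esub> a) = c \<odot>\<^bsub>B\<^esub> \<pi> a) \<and>
     (\<forall>a\<in>carrier A. \<forall>b\<in>carrier A. \<pi> (a \<otimes>\<^bsub>A\<^esub> b) = \<pi> a \<otimes>\<^bsub>B\<^esub> \<pi> b) \<and>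
     (\<forall>a\<in>carrier A. \<pi> (star A a) = star B (\<pi> a)) \<and>
     \<pi> \<one>\<^bsub>A\<^esub> = \<one>\<^bsub>B\<^esub>"

text \<open>Bounded operators are extensional functions on the carrier of \<open>H\<close>, so that equality of
  operators is equality of functions.\<close>

definition bounded_ops :: "'h hilb \<Rightarrow> ('h \<Rightarrow> 'h) normed_star_alg" where
  "bounded_ops H =
    \<lparr>carrier = {T \<in> carrier H \<rightarrow>\<^sub>E carrier H.
        (\<forall>\<xi>\<in>carrier H. \<forall>\<eta>\<in>carrier H. T (\<xi> \<oplus>\<^bsub>H\<^esub> \<eta>) = T \<xi> \<oplus>\<^bsub>H\<^esub> T \<eta>) \<and>
        (\<forall>c. \<forall>\<xi>\<in>carrier H. T (c \<odot>\<^bsub>H\<^esub> \<xi>) = c \<odot>\<^bsub>H\<^esub> T \<xi>) \<and>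
        (\<exists>C. \<forall>\<xi>\<in>carrier H. hnorm H (T \<xi>) \<le> C * hnorm H \<xi>)},
     monoid.mult = (\<lambda>S T. \<lambda>\<xi>\<in>carrier H. S (T \<xi>)),
     one = (\<lambda>\<xi>\<in>carrier H. \<xi>),
     zero = (\<lambda>\<xi>\<in>carrier H. \<zero>\<^bsub>H\<^esub>),
     add = (\<lambda>S T. \<lambda>\<xi>\<in>carrier H. S \<xi> \<oplus>\<^bsub>H\<^esub> T \<xi>),
     module.smult = (\<lambda>c T. \<lambda>\<xi>\<in>carrier H. c \<odot>\<^bsub>H\<^esub> T \<xi>),
     star = (\<lambda>T. \<lambda>\<xi>\<in>carrier H.
        THE \<zeta>. \<zeta> \<in> carrier H \<and> (\<forall>\<eta>\<in>carrier H. cip H \<zeta> \<eta> = cip H \<xi> (T \<eta>))),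
     anorm = (\<lambda>T. Sup {hnorm H (T \<xi>) |\<xi>. \<xi> \<in> carrier H \<and> hnorm H \<xi> \<le> 1})\<rparr>"

text \<open>The algebra of uniformly bounded families, with the supremum norm; the inserted \<open>0\<close> only
  matters for an empty index set.\<close>

definition linf_prod :: "'i set \<Rightarrow> ('i \<Rightarrow> 'a normed_star_alg) \<Rightarrow> ('i \<Rightarrow> 'a) normed_star_alg" where
  "linf_prod I B =
    \<lparr>carrier = {a \<in> (\<Pi>\<^sub>E i\<in>I. carrier (B i)). \<exists>C. \<forall>i\<in>I. anorm (B i) (a i) \<le> C},
     monoid.mult = (\<lambda>a b. \<lambda>i\<in>I. a i \<otimes>\<^bsub>B i\<^esub> b i),
     one = (\<lambda>i\<in>I. \<one>\<^bsub>B i\<^esub>),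
     zero = (\<lambda>i\<in>I. \<zero>\<^bsub>B i\<^esub>),
     add = (\<lambda>a b. \<lambda>i\<in>I. a i \<oplus>\<^bsub>B i\<^esub> b i),
     module.smult = (\<lambda>c a. \<lambda>i\<in>I. c \<odot>\<^bsub>B i\<^esub> a i),
     star = (\<lambda>a. \<lambda>i\<in>I. star (B i) (a i)),
     anorm = (\<lambda>a. Sup (insert 0 ((\<lambda>i. anorm (B i) (a i)) ` I)))\<rparr>"

definition ell2 :: "'i set \<Rightarrow> ('i \<Rightarrow> complex) hilb" where
  "ell2 I =
    \<lparr>carrier = {\<xi>. (\<forall>i. i \<notin> I \<longrightarrow> \<xi> i = 0) \<and> (\<lambda>i. (cmod (\<xi> i))\<^sup>2) summable_on I},
     monoid.mult = undefined, one = undefined,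
     zero = (\<lambda>i. 0),
     add = (\<lambda>\<xi> \<eta> i. \<xi> i + \<eta> i),
     module.smult = (\<lambda>c \<xi> i. c * \<xi> i),
     cip = (\<lambda>\<xi> \<eta>. \<Sum>\<^sub>\<infinity>i\<in>I. cnj (\<xi> i) * \<eta> i)\<rparr>"

definition is_orthogonal_projection :: "'h hilb \<Rightarrow> 'h set \<Rightarrow> ('h \<Rightarrow> 'h) \<Rightarrow> bool" where
  "is_orthogonal_projection H K P \<longleftrightarrow> P \<in> carrier (bounded_ops H) \<and>
     (\<forall>\<xi>\<in>carrier H. P \<xi> \<in> K \<and> (\<forall>\<eta>\<in>K. cip H \<eta> (\<xi> \<ominus>\<^bsub>H\<^esub> P \<xi>) = 0))"


section \<open>The reduced C*-algebra\<close>

definition regular_rep ::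
  "'g groupoid \<Rightarrow> 'g \<Rightarrow> ('g \<Rightarrow> complex) \<Rightarrow> ('g \<Rightarrow> complex) \<Rightarrow> 'g \<Rightarrow> complex" where
  "regular_rep G x f = (\<lambda>\<xi>\<in>carrier (ell2 (src_fibre G x)). \<lambda>g.
     if g \<in> src_fibre G x then \<Sum>\<^sub>\<infinity>h\<in>src_fibre G x. f (gmult G g (ginv G h)) * \<xi> h else 0)"

type_synonym 'g op_family = "'g \<Rightarrow> ('g \<Rightarrow> complex) \<Rightarrow> 'g \<Rightarrow> complex"

definition regular_reps :: "'g groupoid \<Rightarrow> ('g \<Rightarrow> complex) \<Rightarrow> 'g op_family" where
  "regular_reps G f = (\<lambda>x\<in>units G. regular_rep G x f)"

text \<open>The norm of \<open>regular_reps G f\<close> in the product of the algebras of bounded operators on the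
  spaces \<open>ell2 (src_fibre G x)\<close> is the reduced norm of \<open>f\<close>, and this product is complete.
  The completion of \<open>Cc G\<close> is therefore realised as the norm closure of the image of \<open>Cc G\<close>, with
  \<open>regular_reps G\<close> as the canonical embedding. The product and the involution of \<open>Cc G\<close>
  correspond to composition and adjoints. The extension of the regular representation at \<open>x\<close> to
  the completion is \<open>\<lambda>a. a x\<close>.\<close>

definition reduced_cstar :: "'g groupoid \<Rightarrow> 'g op_family normed_star_alg" where
  "reduced_cstar G =
    (let B = linf_prod (units G) (\<lambda>x. bounded_ops (ell2 (src_fibre G x)))
     in B\<lparr>carrier := {a \<in> carrier B. \<forall>\<epsilon>>0. \<exists>f\<in>Cc G.
            anorm B (a \<oplus>\<^bsub>B\<^esub> (-1) \<odot>\<^bsub>B\<^esub> regular_reps G f) < \<epsilon>}\<rparr>)"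

text \<open>Faithful conditional expectations onto the continuous functions on the unit space that extend
  restriction of functions. By contractivity and density, there is at most one on the carrier.\<close>

definition canonical_expectation ::
  "'g groupoid \<Rightarrow> ('g op_family \<Rightarrow> 'g \<Rightarrow> complex) \<Rightarrow> bool" where
  "canonical_expectation G E \<longleftrightarrow>
    (let A = reduced_cstar G; \<iota> = regular_reps G in
      E \<in> carrier A \<rightarrow> C_units G \<and>
      (\<forall>a\<in>carrier A. \<forall>b\<in>carrier A. \<forall>x\<in>units G. E (a \<oplus>\<^bsub>A\<^esub> b) x = E a x + E b x) \<and>
      (\<forall>c. \<forall>a\<in>carrier A. \<forall>x\<in>units G. E (c \<odot>\<^bsub>A\<^esub> a) x = c * E a x) \<and>
      (\<forall>a\<in>carrier A. \<forall>x\<in>units G. cmod (E a x) \<le> anorm A a) \<and>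
      (\<forall>a\<in>carrier A. \<forall>x\<in>units G. 0 \<le> E (star A a \<otimes>\<^bsub>A\<^esub> a) x) \<and>
      (\<forall>a\<in>carrier A. \<forall>\<phi>\<in>C_units G. \<forall>\<psi>\<in>C_units G. \<forall>x\<in>units G.
         E (\<iota> \<phi> \<otimes>\<^bsub>A\<^esub> a \<otimes>\<^bsub>A\<^esub> \<iota> \<psi>) x = \<phi> x * E a x * \<psi> x) \<and>
      (\<forall>f\<in>Cc G. \<forall>x\<in>units G. E (\<iota> f) x = f x) \<and>
      (\<forall>a\<in>carrier A. (\<forall>x\<in>units G. E (star A a \<otimes>\<^bsub>A\<^esub> a) x = 0) \<longrightarrow> a = \<zero>\<^bsub>A\<^esub>))"


section \<open>Kazhdan projections\<close>

definition constant_vectors ::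
  "'g groupoid \<Rightarrow> 'h hilb \<Rightarrow> (('g \<Rightarrow> complex) \<Rightarrow> 'h \<Rightarrow> 'h) \<Rightarrow> 'h set" where
  "constant_vectors G H \<rho> = {\<xi> \<in> carrier H. \<forall>f\<in>Cc G. \<rho> f \<xi> = \<rho> (Psi G f) \<xi>}"

text \<open>HOL cannot quantify over Hilbert spaces of all types inside a definition; the quantifier
  ranges over all Hilbert spaces whose vectors form a subset of the type \<open>'g \<Rightarrow> complex\<close>.
  This is no restriction: every unital representation is a direct sum of cyclic ones, and \<open>p\<close> acts
  as the projection onto the constant vectors in a direct sum iff it does so in every summand. A
  cyclic representation space has a dense subset that is an image of \<open>Cc G\<close>, hence has at most
  \<open>|'g \<Rightarrow> complex| ^ \<aleph>\<^sub>0 = |'g \<Rightarrow> complex|\<close> vectors, and so is isomorphic to a Hilbert space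
  carried by a subset of \<open>'g \<Rightarrow> complex\<close>.\<close>

definition kazhdan_projection :: "'g groupoid \<Rightarrow> 'g op_family \<Rightarrow> bool" where
  "kazhdan_projection G p \<longleftrightarrow>
    (let A = reduced_cstar G in
      p \<in> carrier A \<and> p \<otimes>\<^bsub>A\<^esub> p = p \<and> star A p = p \<and>
      (\<forall>(H :: ('g \<Rightarrow> complex) hilb) \<pi>. hilbert_space H \<and> unital_star_hom A (bounded_ops H) \<pi> \<longrightarrow>
         is_orthogonal_projection H (constant_vectors G H (\<lambda>f. \<pi> (regular_reps G f))) (\<pi> p)))"

end

theory Submission
  imports Defs
begin

text \<open>The image \<open>p x\<close> of \<open>p\<close> under the regular representation at \<open>x\<close> is the projection onto the
  constant vectors of \<open>\<ell>\<^sup>2(G\<^sub>x)\<close>. Testing with functions supported in a small bisection shows that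
  these are the constant functions on \<open>G\<^sub>x\<close>. So \<open>p x = 0\<close> if \<open>G\<^sub>x\<close> is infinite, whereas
  \<open>\<langle>\<delta>\<^sub>x, p x \<delta>\<^sub>x\<rangle> = 1 / |G\<^sub>x|\<close> if it is finite. Finally, \<open>E a x = \<langle>\<delta>\<^sub>x, a x \<delta>\<^sub>x\<rangle>\<close> for all \<open>a\<close>: both
  sides are contractive in \<open>a\<close> and agree on \<open>Cc G\<close>.\<close>

section \<open>The Hilbert space of square-summable families\<close>

text \<open>Why constant vectors are constant functions: \<open>Psi G f\<close> lives on the units,
  so it acts over \<open>src_fibre G x\<close> as multiplication by its value at
  \<open>rng G g\<close>, whereas \<open>f\<close> acts through the kernel f(g h^-1). As h runs
  through the source fibre, g h^-1 runs through the whole range fibre of \<open>rng G g\<close>, so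
  on a constant function both actions multiply by the same sum. A bump function at one arrow g x^-1
  isolates a single term of that sum and thereby compares the entries at g and at x. The same kernel
  governs boundedness: its rows are values of f on range fibres, its columns values on source
  fibres, and compactness of the support bounds both uniformly in x, as Schur's test requires. The
  number 1 / |G_x| is the diagonal entry of the averaging operator on G_x. The obstacle is formal:
  \<open>p\<close> can only be tested on records satisfying \<open>hilbert_space\<close>, whose
  completeness clause is sensitive to vectors outside the carrier. The evaluation at x is therefore
  viewed on \<open>ell2_total\<close>, with the same carrier, inner product and bounded operators as
  \<open>ell2\<close>.\<close>

lemma ell2_simps:
  "\<zero>\<^bsub>ell2 I\<^esub> = (\<lambda>i. 0)"
  "\<xi> \<oplus>\<^bsub>ell2 I\<^esub> \<eta> = (\<lambda>i. \<xi> i + \<eta> i)"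
  "c \<odot>\<^bsub>ell2 I\<^esub> \<xi> = (\<lambda>i. c * \<xi> i)"
  "cip (ell2 I) \<xi> \<eta> = (\<Sum>\<^sub>\<infinity>i\<in>I. cnj (\<xi> i) * \<eta> i)"
  by (simp_all add: ell2_def)

lemma ell2_carrier_iff:
  "\<xi> \<in> carrier (ell2 I) \<longleftrightarrow> (\<forall>i. i \<notin> I \<longrightarrow> \<xi> i = 0) \<and> (\<lambda>i. (cmod (\<xi> i))\<^sup>2) summable_on I"
  by (simp add: ell2_def)

lemma ell2_outside: "\<xi> \<in> carrier (ell2 I) \<Longrightarrow> i \<notin> I \<Longrightarrow> \<xi> i = 0"
  by (simp add: ell2_carrier_iff)

lemma ell2_cip_self:
  assumes "\<xi> \<in> carrier (ell2 I)"
  shows "cip (ell2 I) \<xi> \<xi> = complex_of_real (\<Sum>\<^sub>\<infinity>i\<in>I. (cmod (\<xi> i))\<^sup>2)"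
proof -
  have "((\<lambda>i. (cmod (\<xi> i))\<^sup>2) has_sum (\<Sum>\<^sub>\<infinity>i\<in>I. (cmod (\<xi> i))\<^sup>2)) I"
    using assms by (simp add: ell2_carrier_iff)
  then have "((\<lambda>i. complex_of_real ((cmod (\<xi> i))\<^sup>2)) has_sum
      complex_of_real (\<Sum>\<^sub>\<infinity>i\<in>I. (cmod (\<xi> i))\<^sup>2)) I"
    by (simp only: has_sum_of_real)
  moreover have "cnj (\<xi> i) * \<xi> i = complex_of_real ((cmod (\<xi> i))\<^sup>2)" for i
    by (metis complex_norm_square mult.commute)
  ultimately show ?thesis
    by (simp add: ell2_simps infsumI)
qed

lemma ell2_hnorm:
  assumes "\<xi> \<in> carrier (ell2 I)"
  shows "hnorm (ell2 I) \<xi> = sqrt (\<Sum>\<^sub>\<infinity>i\<in>I. (cmod (\<xi> i))\<^sup>2)"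
  by (simp add: hnorm_def ell2_cip_self[OF assms])

lemma ell2_hnorm_nonneg: "\<xi> \<in> carrier (ell2 I) \<Longrightarrow> 0 \<le> hnorm (ell2 I) \<xi>"
  by (simp add: ell2_hnorm infsum_nonneg)

lemma L2_set_le_ell2_hnorm:
  assumes "\<xi> \<in> carrier (ell2 I)" "finite F" "F \<subseteq> I"
  shows "L2_set (\<lambda>i. cmod (\<xi> i)) F \<le> hnorm (ell2 I) \<xi>"
  unfolding ell2_hnorm[OF assms(1)] L2_set_def
  using assms by (intro real_sqrt_le_mono finite_sum_le_infsum) (auto simp: ell2_carrier_iff)

text \<open>Both membership in \<open>ell2 I\<close> and the norm can be read off from finite
  subsets of I, where the inequalities for \<open>L2_set\<close> are available. Sums, multiples,
  limits, coordinate vectors and Schur's test all pass through this criterion.\<close>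

lemma ell2_bounded_L2_set:
  assumes zero: "\<And>i. i \<notin> I \<Longrightarrow> \<xi> i = 0"
    and le: "\<And>F. finite F \<Longrightarrow> F \<subseteq> I \<Longrightarrow> L2_set (\<lambda>i. cmod (\<xi> i)) F \<le> C"
  shows "\<xi> \<in> carrier (ell2 I)" "hnorm (ell2 I) \<xi> \<le> C"
proof -
  \<comment> \<open>The empty set already forces the bound to be nonnegative, which allows squaring
    it.\<close>
  have C: "0 \<le> C"
    using le[of "{}"] by simp
  have sq: "(\<Sum>i\<in>F. (cmod (\<xi> i))\<^sup>2) \<le> C\<^sup>2" if "finite F" "F \<subseteq> I" for F
    using le[OF that] C by (simp add: L2_set_def sqrt_le_D)
  then have "(\<lambda>i. (cmod (\<xi> i))\<^sup>2) summable_on I"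
    by (intro nonneg_bdd_above_summable_on bdd_aboveI2[of _ _ "C\<^sup>2"]) auto
  then show mem: "\<xi> \<in> carrier (ell2 I)"
    using zero by (simp add: ell2_carrier_iff)
  have "(\<Sum>\<^sub>\<infinity>i\<in>I. (cmod (\<xi> i))\<^sup>2) \<le> C\<^sup>2"
    using mem sq by (intro infsum_le_finite_sums) (auto simp: ell2_carrier_iff)
  then show "hnorm (ell2 I) \<xi> \<le> C"
    unfolding ell2_hnorm[OF mem] using C by (simp add: real_le_lsqrt)
qed

lemma ell2_cmod_le_hnorm:
  assumes "\<xi> \<in> carrier (ell2 I)"
  shows "cmod (\<xi> i) \<le> hnorm (ell2 I) \<xi>"
proof (cases "i \<in> I")
  case True
  then show ?thesis
    using L2_set_le_ell2_hnorm[OF assms, of "{i}"] by simp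
next
  case False
  then show ?thesis
    using assms ell2_hnorm_nonneg[OF assms] by (simp add: ell2_carrier_iff)
qed

lemma ell2_zero_closed: "(\<lambda>i. 0) \<in> carrier (ell2 I)"
  by (simp add: ell2_carrier_iff)

lemma ell2_add:
  assumes "\<xi> \<in> carrier (ell2 I)" "\<eta> \<in> carrier (ell2 I)"
  shows "(\<lambda>i. \<xi> i + \<eta> i) \<in> carrier (ell2 I)"
    and "hnorm (ell2 I) (\<lambda>i. \<xi> i + \<eta> i) \<le> hnorm (ell2 I) \<xi> + hnorm (ell2 I) \<eta>"
proof -
  have "L2_set (\<lambda>i. cmod (\<xi> i + \<eta> i)) F \<le> hnorm (ell2 I) \<xi> + hnorm (ell2 I) \<eta>"
    if F: "finite F" "F \<subseteq> I" for F
  proof -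
    have "L2_set (\<lambda>i. cmod (\<xi> i + \<eta> i)) F \<le> L2_set (\<lambda>i. cmod (\<xi> i) + cmod (\<eta> i)) F"
      by (intro L2_set_mono norm_triangle_ineq) auto
    also have "\<dots> \<le> L2_set (\<lambda>i. cmod (\<xi> i)) F + L2_set (\<lambda>i. cmod (\<eta> i)) F"
      by (rule L2_set_triangle_ineq)
    also have "\<dots> \<le> hnorm (ell2 I) \<xi> + hnorm (ell2 I) \<eta>"
      using assms F by (intro add_mono L2_set_le_ell2_hnorm)
    finally show ?thesis .
  qed
  note * = ell2_bounded_L2_set[of I "\<lambda>i. \<xi> i + \<eta> i", OF _ this]
  show "(\<lambda>i. \<xi> i + \<eta> i) \<in> carrier (ell2 I)"
    and "hnorm (ell2 I) (\<lambda>i. \<xi> i + \<eta> i) \<le> hnorm (ell2 I) \<xi> + hnorm (ell2 I) \<eta>"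
    using assms * by (simp_all add: ell2_outside)
qed

lemma ell2_scale:
  assumes "\<xi> \<in> carrier (ell2 I)"
  shows "(\<lambda>i. c * \<xi> i) \<in> carrier (ell2 I)"
    and "hnorm (ell2 I) (\<lambda>i. c * \<xi> i) \<le> cmod c * hnorm (ell2 I) \<xi>"
proof -
  have "L2_set (\<lambda>i. cmod (c * \<xi> i)) F \<le> cmod c * hnorm (ell2 I) \<xi>"
    if "finite F" "F \<subseteq> I" for F
    using L2_set_le_ell2_hnorm[OF assms that]
    by (simp add: norm_mult mult_left_mono flip: L2_set_right_distrib)
  note * = ell2_bounded_L2_set[of I "\<lambda>i. c * \<xi> i", OF _ this]
  show "(\<lambda>i. c * \<xi> i) \<in> carrier (ell2 I)"
    and "hnorm (ell2 I) (\<lambda>i. c * \<xi> i) \<le> cmod c * hnorm (ell2 I) \<xi>"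
    using assms * by (simp_all add: ell2_outside)
qed

lemma ell2_diff:
  assumes "\<xi> \<in> carrier (ell2 I)" "\<eta> \<in> carrier (ell2 I)"
  shows "(\<lambda>i. \<xi> i - \<eta> i) \<in> carrier (ell2 I)"
  using ell2_add(1)[OF assms(1) ell2_scale(1)[OF assms(2), of "-1"]] by simp

lemma ell2_cip_summable:
  assumes "\<xi> \<in> carrier (ell2 I)" "\<eta> \<in> carrier (ell2 I)"
  shows "(\<lambda>i. cnj (\<xi> i) * \<eta> i) summable_on I"
proof (rule abs_summable_summable, rule summable_on_comparison_test)
  show "(\<lambda>i. (cmod (\<xi> i))\<^sup>2 + (cmod (\<eta> i))\<^sup>2) summable_on I"
    using assms by (intro summable_on_add) (auto simp: ell2_carrier_iff)
  fix i
  have "2 * (cmod (\<xi> i) * cmod (\<eta> i)) \<le> (cmod (\<xi> i))\<^sup>2 + (cmod (\<eta> i))\<^sup>2"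
    using sum_squares_bound[of "cmod (\<xi> i)" "cmod (\<eta> i)"] by simp
  then show "cmod (cnj (\<xi> i) * \<eta> i) \<le> (cmod (\<xi> i))\<^sup>2 + (cmod (\<eta> i))\<^sup>2"
    using mult_nonneg_nonneg[OF norm_ge_zero[of "\<xi> i"] norm_ge_zero[of "\<eta> i"]]
    unfolding norm_mult complex_mod_cnj by linarith
qed auto

section \<open>A copy of \<open>ell2\<close> whose addition is sensible on the whole type\<close>

definition ell2_part :: "'i set \<Rightarrow> ('i \<Rightarrow> complex) \<Rightarrow> 'i \<Rightarrow> complex" where
  "ell2_part I \<xi> = (if \<xi> \<in> carrier (ell2 I) then \<xi> else (\<lambda>i. 0))"

text \<open>\<open>Metric_space\<close> demands a distance that is symmetric on the whole type, and the definition of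
  \<open>Metric_space.mcomplete\<close> unfolds only for such distances. In \<open>ell2 I\<close> the difference is junk for
  vectors outside the carrier; here these vectors are treated as \<open>0\<close>.\<close>

definition ell2_total :: "'i set \<Rightarrow> ('i \<Rightarrow> complex) hilb" where
  "ell2_total I = (ell2 I)\<lparr>add := \<lambda>\<xi> \<eta> i. ell2_part I \<xi> i + ell2_part I \<eta> i\<rparr>"

lemma ell2_part_closed [simp]: "ell2_part I \<xi> \<in> carrier (ell2 I)"
  by (simp add: ell2_part_def ell2_zero_closed)

lemma ell2_part_id [simp]: "\<xi> \<in> carrier (ell2 I) \<Longrightarrow> ell2_part I \<xi> = \<xi>"
  by (simp add: ell2_part_def)

lemma ell2_total_simps:
  "carrier (ell2_total I) = carrier (ell2 I)"
  "\<zero>\<^bsub>ell2_total I\<^esub> = (\<lambda>i. 0)"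
  "\<xi> \<oplus>\<^bsub>ell2_total I\<^esub> \<eta> = (\<lambda>i. ell2_part I \<xi> i + ell2_part I \<eta> i)"
  "c \<odot>\<^bsub>ell2_total I\<^esub> \<xi> = (\<lambda>i. c * \<xi> i)"
  "cip (ell2_total I) = cip (ell2 I)"
  "hnorm (ell2_total I) = hnorm (ell2 I)"
  by (simp_all add: ell2_total_def ell2_simps hnorm_def fun_eq_iff)

lemma ell2_neg_closed: "\<xi> \<in> carrier (ell2 I) \<Longrightarrow> (\<lambda>i. - \<xi> i) \<in> carrier (ell2 I)"
  using ell2_scale(1)[of \<xi> I "-1"] by simp

text \<open>No membership is assumed: the new addition reads a vector outside the carrier as 0, and
  its unique inverse inside the carrier is then 0 as well. This makes the distance below symmetric
  for all vectors.\<close>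

lemma ell2_total_minus:
  "\<xi> \<ominus>\<^bsub>ell2_total I\<^esub> \<eta> = (\<lambda>i. ell2_part I \<xi> i - ell2_part I \<eta> i)"
proof -
  have neg: "(\<lambda>i. - ell2_part I \<eta> i) \<in> carrier (ell2 I)"
    by (simp add: ell2_neg_closed)
  have "\<ominus>\<^bsub>ell2_total I\<^esub> \<eta> = (\<lambda>i. - ell2_part I \<eta> i)"
    unfolding a_inv_def m_inv_def
    using neg by (intro the_equality)
      (auto simp: ell2_total_simps fun_eq_iff eq_neg_iff_add_eq_0 add.commute)
  then show ?thesis
    using neg by (simp add: a_minus_def ell2_total_simps)
qed

lemma ell2_total_abelian_group: "abelian_group (ell2_total I)"
proof (rule abelian_groupI)
  fix \<xi> assume "\<xi> \<in> carrier (ell2_total I)"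
  then show "\<exists>\<eta>\<in>carrier (ell2_total I). \<eta> \<oplus>\<^bsub>ell2_total I\<^esub> \<xi> = \<zero>\<^bsub>ell2_total I\<^esub>"
    by (intro bexI[of _ "\<lambda>i. - \<xi> i"]) (simp_all add: ell2_total_simps ell2_neg_closed)
qed (auto simp: ell2_total_simps ell2_zero_closed ell2_add ac_simps)

lemma complex_ring_cring: "cring complex_ring"
proof (rule cringI)
  show "abelian_group complex_ring"
    by (rule abelian_groupI) (auto simp: complex_ring_def intro: exI[of _ "- _"])
  show "comm_monoid complex_ring"
    by (rule comm_monoidI) (auto simp: complex_ring_def)
qed (auto simp: complex_ring_def algebra_simps)

lemma ell2_total_module: "Module.module complex_ring (ell2_total I)"
  by (intro moduleI complex_ring_cring ell2_total_abelian_group)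
    (auto simp: ell2_total_simps ell2_scale ell2_add complex_ring_def algebra_simps)

lemma ell2_hnorm_minus_commute:
  "hnorm (ell2 I) (\<lambda>i. \<xi> i - \<eta> i) = hnorm (ell2 I) (\<lambda>i. \<eta> i - \<xi> i)"
  by (simp add: hnorm_def ell2_simps algebra_simps)

lemma ell2_total_Metric_space:
  "Metric_space (carrier (ell2_total I)) (\<lambda>\<xi> \<eta>. hnorm (ell2_total I) (\<xi> \<ominus>\<^bsub>ell2_total I\<^esub> \<eta>))"
proof
  fix \<xi> \<eta> \<zeta>
  show "0 \<le> hnorm (ell2_total I) (\<xi> \<ominus>\<^bsub>ell2_total I\<^esub> \<eta>)"
    by (simp add: ell2_total_simps ell2_total_minus ell2_hnorm_nonneg ell2_diff)
  show "hnorm (ell2_total I) (\<xi> \<ominus>\<^bsub>ell2_total I\<^esub> \<eta>) = hnorm (ell2_total I) (\<eta> \<ominus>\<^bsub>ell2_total I\<^esub> \<xi>)"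
    by (simp add: ell2_total_simps ell2_total_minus ell2_hnorm_minus_commute[of I "ell2_part I \<xi>"])
  assume "\<xi> \<in> carrier (ell2_total I)" "\<eta> \<in> carrier (ell2_total I)"
  then have mem: "\<xi> \<in> carrier (ell2 I)" "\<eta> \<in> carrier (ell2 I)"
    by (simp_all add: ell2_total_simps)
  show "(hnorm (ell2_total I) (\<xi> \<ominus>\<^bsub>ell2_total I\<^esub> \<eta>) = 0) = (\<xi> = \<eta>)"
  proof
    assume "hnorm (ell2_total I) (\<xi> \<ominus>\<^bsub>ell2_total I\<^esub> \<eta>) = 0"
    then show "\<xi> = \<eta>"
      using ell2_cmod_le_hnorm[OF ell2_diff[OF mem]] mem
      by (simp add: ell2_total_simps ell2_total_minus fun_eq_iff)
  qed (simp add: ell2_total_simps ell2_total_minus hnorm_def ell2_simps)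
  assume "\<zeta> \<in> carrier (ell2_total I)"
  then have \<zeta>: "\<zeta> \<in> carrier (ell2 I)"
    by (simp add: ell2_total_simps)
  show "hnorm (ell2_total I) (\<xi> \<ominus>\<^bsub>ell2_total I\<^esub> \<zeta>) \<le>
      hnorm (ell2_total I) (\<xi> \<ominus>\<^bsub>ell2_total I\<^esub> \<eta>) + hnorm (ell2_total I) (\<eta> \<ominus>\<^bsub>ell2_total I\<^esub> \<zeta>)"
    using ell2_add(2)[OF ell2_diff[OF mem] ell2_diff[OF mem(2) \<zeta>]] mem \<zeta>
    by (simp add: ell2_total_simps ell2_total_minus)
qed

text \<open>The limit is formed coordinate by coordinate. A bound over a finite set of coordinates
  survives this limit, and by \<open>ell2_bounded_L2_set\<close> such bounds give convergence in
  norm.\<close>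

lemma ell2_complete:
  assumes mem: "\<And>n::nat. \<sigma> n \<in> carrier (ell2 I)"
    and Cauchy: "\<And>\<epsilon>. 0 < \<epsilon> \<Longrightarrow>
      \<exists>N. \<forall>m\<ge>N. \<forall>n\<ge>N. hnorm (ell2 I) (\<lambda>i. \<sigma> m i - \<sigma> n i) < \<epsilon>"
  shows "\<exists>\<xi>\<in>carrier (ell2 I). \<forall>\<epsilon>>0. \<exists>N. \<forall>n\<ge>N. hnorm (ell2 I) (\<lambda>i. \<sigma> n i - \<xi> i) < \<epsilon>"
proof -
  have "Cauchy (\<lambda>n. \<sigma> n i)" for i
    unfolding Cauchy_def dist_norm
    using Cauchy ell2_cmod_le_hnorm[OF ell2_diff[OF mem mem], where i = i] by (meson le_less_trans)
  then have lim: "(\<lambda>n. \<sigma> n i) \<longlonglongrightarrow> lim (\<lambda>n. \<sigma> n i)" for i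
    by (simp add: Cauchy_convergent_iff convergent_LIMSEQ_iff)
  define \<xi> where "\<xi> i = lim (\<lambda>n. \<sigma> n i)" for i
  have outside: "\<xi> i = 0" if "i \<notin> I" for i
    using that by (simp add: \<xi>_def ell2_outside[OF mem])
  have L2_le: "L2_set (\<lambda>i. cmod (\<sigma> m i - \<xi> i)) F \<le> \<epsilon>"
    if F: "finite F" "F \<subseteq> I" and N: "\<forall>n\<ge>N. hnorm (ell2 I) (\<lambda>i. \<sigma> m i - \<sigma> n i) < \<epsilon>"
    for F N m \<epsilon>
  proof (rule LIMSEQ_le_const2)
    show "(\<lambda>n. L2_set (\<lambda>i. cmod (\<sigma> m i - \<sigma> n i)) F) \<longlonglongrightarrow> L2_set (\<lambda>i. cmod (\<sigma> m i - \<xi> i)) F"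
      unfolding L2_set_def \<xi>_def by (intro tendsto_intros lim)
    show "\<exists>N. \<forall>n\<ge>N. L2_set (\<lambda>i. cmod (\<sigma> m i - \<sigma> n i)) F \<le> \<epsilon>"
      using N L2_set_le_ell2_hnorm[OF ell2_diff[OF mem mem] F] by (meson le_less_trans less_imp_le)
  qed
  have near: "\<exists>N. \<forall>m\<ge>N. (\<lambda>i. \<sigma> m i - \<xi> i) \<in> carrier (ell2 I) \<and>
      hnorm (ell2 I) (\<lambda>i. \<sigma> m i - \<xi> i) < \<epsilon>" if "0 < \<epsilon>" for \<epsilon>
  proof -
    \<comment> \<open>Half of the tolerance, since the limit turns a strict bound into a weak
      one.\<close>
    obtain N where N: "\<forall>m\<ge>N. \<forall>n\<ge>N. hnorm (ell2 I) (\<lambda>i. \<sigma> m i - \<sigma> n i) < \<epsilon> / 2"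
      using Cauchy[of "\<epsilon> / 2"] \<open>0 < \<epsilon>\<close> by auto
    have "(\<lambda>i. \<sigma> m i - \<xi> i) \<in> carrier (ell2 I) \<and>
      hnorm (ell2 I) (\<lambda>i. \<sigma> m i - \<xi> i) \<le> \<epsilon> / 2" if "N \<le> m" for m
      using ell2_bounded_L2_set[of I "\<lambda>i. \<sigma> m i - \<xi> i" "\<epsilon> / 2"] outside
        L2_le[of _ N m "\<epsilon> / 2"] N that
      by (auto simp: ell2_outside[OF mem])
    then show ?thesis
      using \<open>0 < \<epsilon>\<close> by (intro exI[of _ N]) force
  qed
  moreover have "\<xi> \<in> carrier (ell2 I)"
  proof -
    \<comment> \<open>The limit is the difference of two members of the space,
      \<open>\<sigma> m\<close> and \<open>\<sigma> m - \<xi>\<close>.\<close>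
    obtain m where "(\<lambda>i. \<sigma> m i - \<xi> i) \<in> carrier (ell2 I)"
      using near[of 1] by auto
    from ell2_diff[OF mem[of m] this] show ?thesis
      by simp
  qed
  ultimately show ?thesis
    by blast
qed

lemma ell2_total_hilbert_space: "hilbert_space (ell2_total I)"
proof (intro hilbert_space.intro hilbert_space_axioms.intro ell2_total_module)
  fix \<xi> \<eta> \<zeta>
  assume "\<xi> \<in> carrier (ell2_total I)" "\<eta> \<in> carrier (ell2_total I)" "\<zeta> \<in> carrier (ell2_total I)"
  then show "cip (ell2_total I) \<xi> (\<eta> \<oplus>\<^bsub>ell2_total I\<^esub> \<zeta>) =
      cip (ell2_total I) \<xi> \<eta> + cip (ell2_total I) \<xi> \<zeta>"
    by (simp add: ell2_total_simps ell2_simps distrib_left infsum_add ell2_cip_summable)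
next
  fix \<xi> \<eta> c
  show "cip (ell2_total I) \<xi> (c \<odot>\<^bsub>ell2_total I\<^esub> \<eta>) = c * cip (ell2_total I) \<xi> \<eta>"
    by (simp add: ell2_total_simps ell2_simps mult.left_commute infsum_cmult_right')
next
  fix \<xi> \<eta>
  show "cip (ell2_total I) \<eta> \<xi> = cnj (cip (ell2_total I) \<xi> \<eta>)"
    by (simp add: ell2_total_simps ell2_simps mult.commute flip: infsum_cnj)
next
  fix \<xi> assume "\<xi> \<in> carrier (ell2_total I)" and nz: "\<xi> \<noteq> \<zero>\<^bsub>ell2_total I\<^esub>"
  then have \<xi>: "\<xi> \<in> carrier (ell2 I)"
    by (simp add: ell2_total_simps)
  obtain i where "\<xi> i \<noteq> 0"
    using nz by (auto simp: ell2_total_simps)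
  then have "0 < hnorm (ell2 I) \<xi>"
    using ell2_cmod_le_hnorm[OF \<xi>, of i] by (smt (verit) zero_less_norm_iff)
  then show "0 < cip (ell2_total I) \<xi> \<xi>"
    by (simp add: ell2_total_simps ell2_cip_self[OF \<xi>] ell2_hnorm[OF \<xi>] less_complex_def)
next
  let ?d = "\<lambda>\<xi> \<eta>. hnorm (ell2_total I) (\<xi> \<ominus>\<^bsub>ell2_total I\<^esub> \<eta>)"
  interpret Metric_space "carrier (ell2_total I)" ?d
    by (rule ell2_total_Metric_space)
  have d: "?d \<xi> \<eta> = hnorm (ell2 I) (\<lambda>i. \<xi> i - \<eta> i)"
    if "\<xi> \<in> carrier (ell2 I)" "\<eta> \<in> carrier (ell2 I)" for \<xi> \<eta>
    using that by (simp add: ell2_total_simps ell2_total_minus)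
  show mcomplete
    unfolding mcomplete_def
  proof (intro allI impI)
    fix \<sigma> assume "MCauchy \<sigma>"
    then have mem: "\<sigma> n \<in> carrier (ell2 I)"
      and "0 < \<epsilon> \<Longrightarrow> \<exists>N. \<forall>m\<ge>N. \<forall>n\<ge>N. ?d (\<sigma> m) (\<sigma> n) < \<epsilon>" for n \<epsilon>
      unfolding MCauchy_def by (auto simp: ell2_total_simps(1) image_subset_iff)
    then have "0 < \<epsilon> \<Longrightarrow> \<exists>N. \<forall>m\<ge>N. \<forall>n\<ge>N. hnorm (ell2 I) (\<lambda>i. \<sigma> m i - \<sigma> n i) < \<epsilon>" for \<epsilon>
      by (simp add: d)
    from ell2_complete[OF mem this] obtain \<xi> where \<xi>: "\<xi> \<in> carrier (ell2 I)"
      "\<forall>\<epsilon>>0. \<exists>N. \<forall>n\<ge>N. hnorm (ell2 I) (\<lambda>i. \<sigma> n i - \<xi> i) < \<epsilon>"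
      by blast
    then have "limitin mtopology \<sigma> \<xi> sequentially"
      unfolding limitin_metric eventually_sequentially by (simp add: mem d ell2_total_simps(1))
    then show "\<exists>\<xi>. limitin mtopology \<sigma> \<xi> sequentially"
      by blast
  qed
qed


section \<open>Bounded operators\<close>

lemma bounded_ops_ell2_carrier_iff:
  "T \<in> carrier (bounded_ops (ell2 I)) \<longleftrightarrow>
    T \<in> carrier (ell2 I) \<rightarrow>\<^sub>E carrier (ell2 I) \<and>
    (\<forall>\<xi>\<in>carrier (ell2 I). \<forall>\<eta>\<in>carrier (ell2 I).
      T (\<lambda>i. \<xi> i + \<eta> i) = (\<lambda>i. T \<xi> i + T \<eta> i)) \<and>
    (\<forall>c. \<forall>\<xi>\<in>carrier (ell2 I). T (\<lambda>i. c * \<xi> i) = (\<lambda>i. c * T \<xi> i)) \<and>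
    (\<exists>C. \<forall>\<xi>\<in>carrier (ell2 I). hnorm (ell2 I) (T \<xi>) \<le> C * hnorm (ell2 I) \<xi>)"
  by (simp add: bounded_ops_def ell2_simps)

lemma bounded_ops_ell2_closed:
  "T \<in> carrier (bounded_ops (ell2 I)) \<Longrightarrow> \<xi> \<in> carrier (ell2 I) \<Longrightarrow> T \<xi> \<in> carrier (ell2 I)"
  by (auto simp: bounded_ops_ell2_carrier_iff)

text \<open>The two additions agree on the carrier, and extensional operators see nothing else.
  Hence the components of an element of the reduced algebra are bounded operators on
  \<open>ell2_total\<close> as they stand.\<close>

lemma bounded_ops_ell2_total_carrier:
  "carrier (bounded_ops (ell2_total I)) = carrier (bounded_ops (ell2 I))"
proof (rule Set.set_eqI)
  fix T
  have "T \<xi> \<oplus>\<^bsub>ell2_total I\<^esub> T \<eta> = (\<lambda>i. T \<xi> i + T \<eta> i)"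
    if "T \<in> carrier (ell2 I) \<rightarrow>\<^sub>E carrier (ell2 I)" "\<xi> \<in> carrier (ell2 I)" "\<eta> \<in> carrier (ell2 I)"
    for \<xi> \<eta>
    using PiE_mem[OF that(1,2)] PiE_mem[OF that(1,3)] by (simp add: ell2_total_simps)
  then show "T \<in> carrier (bounded_ops (ell2_total I)) \<longleftrightarrow> T \<in> carrier (bounded_ops (ell2 I))"
    unfolding bounded_ops_ell2_carrier_iff
    by (auto simp: bounded_ops_def ell2_total_simps)
qed

lemma anorm_bounded_ops_le:
  assumes "\<And>\<xi>. \<xi> \<in> carrier (ell2 I) \<Longrightarrow> hnorm (ell2 I) \<xi> \<le> 1 \<Longrightarrow> hnorm (ell2 I) (T \<xi>) \<le> C"
  shows "anorm (bounded_ops (ell2 I)) T \<le> C"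
proof -
  \<comment> \<open>The zero vector makes the set under the supremum nonempty.\<close>
  have "hnorm (ell2 I) (\<lambda>i. 0) \<le> 1"
    by (simp add: hnorm_def ell2_simps)
  then show ?thesis
    using assms ell2_zero_closed[of I] by (auto simp: bounded_ops_def intro!: cSup_least)
qed

lemma hnorm_le_anorm_bounded_ops:
  assumes T: "T \<in> carrier (bounded_ops (ell2 I))"
    and \<xi>: "\<xi> \<in> carrier (ell2 I)" "hnorm (ell2 I) \<xi> \<le> 1"
  shows "hnorm (ell2 I) (T \<xi>) \<le> anorm (bounded_ops (ell2 I)) T"
proof -
  obtain C where C: "\<And>\<eta>. \<eta> \<in> carrier (ell2 I) \<Longrightarrow> hnorm (ell2 I) (T \<eta>) \<le> C * hnorm (ell2 I) \<eta>"
    using T unfolding bounded_ops_ell2_carrier_iff by blast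
  \<comment> \<open>On a zero space \<open>C\<close> may be negative, hence its absolute
    value.\<close>
  have "hnorm (ell2 I) (T \<eta>) \<le> \<bar>C\<bar>"
    if \<eta>: "\<eta> \<in> carrier (ell2 I)" "hnorm (ell2 I) \<eta> \<le> 1" for \<eta>
  proof -
    have "C * hnorm (ell2 I) \<eta> \<le> \<bar>C\<bar> * 1"
      using \<eta> ell2_hnorm_nonneg by (intro mult_mono) auto
    with C[OF \<eta>(1)] show ?thesis
      by simp
  qed
  then have "bdd_above {hnorm (ell2 I) (T \<eta>) |\<eta>. \<eta> \<in> carrier (ell2 I) \<and> hnorm (ell2 I) \<eta> \<le> 1}"
    by (auto intro!: bdd_aboveI)
  then show ?thesis
    using \<xi> by (auto simp: bounded_ops_def intro!: cSup_upper)
qed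

lemma bounded_ops_ell2_add:
  assumes S: "S \<in> carrier (bounded_ops (ell2 I))" and T: "T \<in> carrier (bounded_ops (ell2 I))"
  shows "S \<oplus>\<^bsub>bounded_ops (ell2 I)\<^esub> T \<in> carrier (bounded_ops (ell2 I))"
    and "anorm (bounded_ops (ell2 I)) (S \<oplus>\<^bsub>bounded_ops (ell2 I)\<^esub> T) \<le>
      anorm (bounded_ops (ell2 I)) S + anorm (bounded_ops (ell2 I)) T"
proof -
  have add: "S \<oplus>\<^bsub>bounded_ops (ell2 I)\<^esub> T = (\<lambda>\<xi>\<in>carrier (ell2 I). \<lambda>i. S \<xi> i + T \<xi> i)"
    by (simp add: bounded_ops_def ell2_simps)
  have tri: "hnorm (ell2 I) (\<lambda>i. S \<xi> i + T \<xi> i) \<le> hnorm (ell2 I) (S \<xi>) + hnorm (ell2 I) (T \<xi>)"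
    if "\<xi> \<in> carrier (ell2 I)" for \<xi>
    using that S T by (simp add: ell2_add(2) bounded_ops_ell2_closed)
  have lin: "S (\<lambda>i. \<xi> i + \<eta> i) = (\<lambda>i. S \<xi> i + S \<eta> i)" "T (\<lambda>i. \<xi> i + \<eta> i) = (\<lambda>i. T \<xi> i + T \<eta> i)"
    "S (\<lambda>i. c * \<xi> i) = (\<lambda>i. c * S \<xi> i)" "T (\<lambda>i. c * \<xi> i) = (\<lambda>i. c * T \<xi> i)"
    if "\<xi> \<in> carrier (ell2 I)" "\<eta> \<in> carrier (ell2 I)" for \<xi> \<eta> c
    using S T that unfolding bounded_ops_ell2_carrier_iff by blast+
  obtain C D where
    "\<forall>\<xi>\<in>carrier (ell2 I). hnorm (ell2 I) (S \<xi>) \<le> C * hnorm (ell2 I) \<xi>"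
    "\<forall>\<xi>\<in>carrier (ell2 I). hnorm (ell2 I) (T \<xi>) \<le> D * hnorm (ell2 I) \<xi>"
    using S T unfolding bounded_ops_ell2_carrier_iff by blast
  then have "\<forall>\<xi>\<in>carrier (ell2 I).
      hnorm (ell2 I) (\<lambda>i. S \<xi> i + T \<xi> i) \<le> (C + D) * hnorm (ell2 I) \<xi>"
    using tri by (fastforce simp: distrib_right)
  then have "\<forall>\<xi>\<in>carrier (ell2 I). hnorm (ell2 I)
      ((S \<oplus>\<^bsub>bounded_ops (ell2 I)\<^esub> T) \<xi>) \<le> (C + D) * hnorm (ell2 I) \<xi>"
    by (simp add: add)
  moreover have "S \<oplus>\<^bsub>bounded_ops (ell2 I)\<^esub> T \<in> carrier (ell2 I) \<rightarrow>\<^sub>E carrier (ell2 I)"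
    using ell2_add(1)[OF bounded_ops_ell2_closed[OF S] bounded_ops_ell2_closed[OF T]]
    by (simp add: add)
  moreover have "\<forall>\<xi>\<in>carrier (ell2 I). \<forall>\<eta>\<in>carrier (ell2 I).
      (S \<oplus>\<^bsub>bounded_ops (ell2 I)\<^esub> T) (\<lambda>i. \<xi> i + \<eta> i) =
      (\<lambda>i. (S \<oplus>\<^bsub>bounded_ops (ell2 I)\<^esub> T) \<xi> i + (S \<oplus>\<^bsub>bounded_ops (ell2 I)\<^esub> T) \<eta> i)"
    by (simp add: add lin ell2_add(1) ac_simps)
  moreover have "\<forall>c. \<forall>\<xi>\<in>carrier (ell2 I). (S \<oplus>\<^bsub>bounded_ops (ell2 I)\<^esub> T) (\<lambda>i. c * \<xi> i) =
      (\<lambda>i. c * (S \<oplus>\<^bsub>bounded_ops (ell2 I)\<^esub> T) \<xi> i)"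
    by (auto simp: add lin ell2_scale(1) distrib_left)
  ultimately show "S \<oplus>\<^bsub>bounded_ops (ell2 I)\<^esub> T \<in> carrier (bounded_ops (ell2 I))"
    unfolding bounded_ops_ell2_carrier_iff by (intro conjI exI[of _ "C + D"])
  show "anorm (bounded_ops (ell2 I)) (S \<oplus>\<^bsub>bounded_ops (ell2 I)\<^esub> T) \<le>
      anorm (bounded_ops (ell2 I)) S + anorm (bounded_ops (ell2 I)) T"
  proof (rule anorm_bounded_ops_le)
    fix \<xi> assume "\<xi> \<in> carrier (ell2 I)" "hnorm (ell2 I) \<xi> \<le> 1"
    then show "hnorm (ell2 I) ((S \<oplus>\<^bsub>bounded_ops (ell2 I)\<^esub> T) \<xi>) \<le>
        anorm (bounded_ops (ell2 I)) S + anorm (bounded_ops (ell2 I)) T"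
      using tri[of \<xi>] hnorm_le_anorm_bounded_ops[OF S, of \<xi>] hnorm_le_anorm_bounded_ops[OF T, of \<xi>]
      by (simp add: add)
  qed
qed

lemma infsum_finite_support:
  fixes f :: "'a \<Rightarrow> 'b::{comm_monoid_add, t2_space}"
  assumes "finite A" "A \<subseteq> I" "\<And>h. h \<in> I - A \<Longrightarrow> f h = 0"
  shows "f summable_on I" "infsum f I = sum f A"
proof -
  show "f summable_on I"
    using assms summable_on_cong_neutral[of A I f f] by auto
  have "infsum f I = infsum f A"
    using assms by (intro infsum_cong_neutral) auto
  then show "infsum f I = sum f A"
    using assms(1) by simp
qed

text \<open>Splitting \<open>cmod (k g h)\<close> into two square roots and applying Cauchy-Schwarz
  along row g leaves a row sum, at most M, times the sum of \<open>cmod (k g h)\<close> weighted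
  with the squared entries of the vector. Summing over g turns the second factor into column sums,
  again at most M.\<close>

lemma schur_test:
  fixes k :: "'i \<Rightarrow> 'i \<Rightarrow> complex"
  assumes fin: "\<And>g. g \<in> I \<Longrightarrow> finite {h \<in> I. k g h \<noteq> 0}"
    and row: "\<And>g F. g \<in> I \<Longrightarrow> finite F \<Longrightarrow> F \<subseteq> I \<Longrightarrow> (\<Sum>h\<in>F. cmod (k g h)) \<le> M"
    and col: "\<And>h F. h \<in> I \<Longrightarrow> finite F \<Longrightarrow> F \<subseteq> I \<Longrightarrow> (\<Sum>g\<in>F. cmod (k g h)) \<le> M"
    and M: "0 \<le> M"
  defines "T \<equiv> \<lambda>\<xi>\<in>carrier (ell2 I). \<lambda>g. if g \<in> I then \<Sum>\<^sub>\<infinity>h\<in>I. k g h * \<xi> h else 0"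
  shows "T \<in> carrier (bounded_ops (ell2 I))" "anorm (bounded_ops (ell2 I)) T \<le> M"
proof -
  have L2: "L2_set (\<lambda>g. cmod (T \<xi> g)) F \<le> M * hnorm (ell2 I) \<xi>"
    if \<xi>: "\<xi> \<in> carrier (ell2 I)" and F: "finite F" "F \<subseteq> I" for \<xi> F
  proof -
    \<comment> \<open>Only finitely many columns meet the rows in F, so every sum in the estimate is
      finite.\<close>
    define H where "H = (\<Union>g\<in>F. {h \<in> I. k g h \<noteq> 0})"
    have H: "finite H" "H \<subseteq> I"
      using F fin by (auto simp: H_def)
    have entry: "(cmod (T \<xi> g))\<^sup>2 \<le> M * (\<Sum>h\<in>H. cmod (k g h) * (cmod (\<xi> h))\<^sup>2)" if "g \<in> F" for g
    proof -
      have "T \<xi> g = (\<Sum>h\<in>H. k g h * \<xi> h)"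
        using infsum_finite_support(2)[of H I "\<lambda>h. k g h * \<xi> h"] H that F \<xi>
        by (auto simp: T_def H_def)
      then have "cmod (T \<xi> g) \<le> (\<Sum>h\<in>H. sqrt (cmod (k g h)) * (sqrt (cmod (k g h)) * cmod (\<xi> h)))"
        by (simp add: sum_norm_le norm_mult flip: mult.assoc)
      then have "(cmod (T \<xi> g))\<^sup>2 \<le>
          (\<Sum>h\<in>H. sqrt (cmod (k g h)) * (sqrt (cmod (k g h)) * cmod (\<xi> h)))\<^sup>2"
        by (simp add: power_mono)
      also have "\<dots> \<le> (\<Sum>h\<in>H. (sqrt (cmod (k g h)))\<^sup>2) *
          (\<Sum>h\<in>H. (sqrt (cmod (k g h)) * cmod (\<xi> h))\<^sup>2)"
        by (rule Cauchy_Schwarz_ineq_sum)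
      also have "\<dots> = (\<Sum>h\<in>H. cmod (k g h)) * (\<Sum>h\<in>H. cmod (k g h) * (cmod (\<xi> h))\<^sup>2)"
        by (simp add: power_mult_distrib)
      also have "\<dots> \<le> M * (\<Sum>h\<in>H. cmod (k g h) * (cmod (\<xi> h))\<^sup>2)"
        using that F H by (intro mult_right_mono row sum_nonneg) auto
      finally show ?thesis .
    qed
    have "(\<Sum>g\<in>F. (cmod (T \<xi> g))\<^sup>2) \<le> (\<Sum>g\<in>F. M * (\<Sum>h\<in>H. cmod (k g h) * (cmod (\<xi> h))\<^sup>2))"
      by (intro sum_mono entry)
    also have "\<dots> = M * (\<Sum>h\<in>H. (\<Sum>g\<in>F. cmod (k g h)) * (cmod (\<xi> h))\<^sup>2)"
      by (simp only: sum_distrib_left[symmetric] sum_distrib_right sum.swap[of _ H F])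
    also have "\<dots> \<le> M * (\<Sum>h\<in>H. M * (cmod (\<xi> h))\<^sup>2)"
      using F H M by (intro mult_left_mono sum_mono mult_right_mono col) auto
    also have "\<dots> = (M * L2_set (\<lambda>h. cmod (\<xi> h)) H)\<^sup>2"
      by (simp add: L2_set_def power_mult_distrib sum_nonneg power2_eq_square[of M]
          flip: sum_distrib_left)
    finally have "L2_set (\<lambda>g. cmod (T \<xi> g)) F \<le> M * L2_set (\<lambda>h. cmod (\<xi> h)) H"
      unfolding L2_set_def[of _ F] using M by (intro real_le_lsqrt) (auto simp: sum_nonneg)
    also have "\<dots> \<le> M * hnorm (ell2 I) \<xi>"
      using M L2_set_le_ell2_hnorm[OF \<xi> H] by (intro mult_left_mono)
    finally show ?thesis .
  qed
  have closed: "T \<xi> \<in> carrier (ell2 I)" and bound: "hnorm (ell2 I) (T \<xi>) \<le> M * hnorm (ell2 I) \<xi>"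
    if "\<xi> \<in> carrier (ell2 I)" for \<xi>
    using ell2_bounded_L2_set[of I "T \<xi>", OF _ L2[OF that]] that by (auto simp: T_def)
  have "(\<lambda>h. k g h * \<xi> h) summable_on I" if "g \<in> I" for g \<xi>
    using infsum_finite_support(1)[of "{h \<in> I. k g h \<noteq> 0}" I "\<lambda>h. k g h * \<xi> h"] fin[OF that]
    by auto
  then have "T (\<lambda>i. \<xi> i + \<eta> i) = (\<lambda>i. T \<xi> i + T \<eta> i)"
    if "\<xi> \<in> carrier (ell2 I)" "\<eta> \<in> carrier (ell2 I)" for \<xi> \<eta>
    using that by (auto simp: T_def ell2_add(1) distrib_left infsum_add)
  moreover have "T (\<lambda>i. c * \<xi> i) = (\<lambda>i. c * T \<xi> i)" if "\<xi> \<in> carrier (ell2 I)" for c \<xi>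
    using that by (auto simp: T_def ell2_scale(1) mult.left_commute[of _ c] infsum_cmult_right')
  moreover have "T \<in> carrier (ell2 I) \<rightarrow>\<^sub>E carrier (ell2 I)"
    using closed by (auto simp: T_def)
  ultimately show "T \<in> carrier (bounded_ops (ell2 I))"
    unfolding bounded_ops_ell2_carrier_iff using bound by blast
  show "anorm (bounded_ops (ell2 I)) T \<le> M"
  proof (rule anorm_bounded_ops_le)
    fix \<xi> assume "\<xi> \<in> carrier (ell2 I)" "hnorm (ell2 I) \<xi> \<le> 1"
    with bound[of \<xi>] mult_left_mono[of "hnorm (ell2 I) \<xi>" 1 M] M
    show "hnorm (ell2 I) (T \<xi>) \<le> M"
      by simp
  qed
qed

lemma anorm_component_le_linf_prod:
  assumes "a \<in> carrier (linf_prod I B)" "i \<in> I"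
  shows "anorm (B i) (a i) \<le> anorm (linf_prod I B) a"
proof -
  obtain C where "\<forall>i\<in>I. anorm (B i) (a i) \<le> C"
    using assms by (auto simp: linf_prod_def)
  then have "bdd_above (insert 0 ((\<lambda>i. anorm (B i) (a i)) ` I))"
    by (auto intro!: bdd_aboveI)
  then show ?thesis
    using assms(2) by (auto simp: linf_prod_def intro!: cSup_upper)
qed


section \<open>Etale groupoids\<close>

context topological_groupoid
begin

lemma units_arrows: "x \<in> units G \<Longrightarrow> x \<in> arrows G"
  by (auto simp: units_def rng_closed)

lemma rng_of_unit: "x \<in> units G \<Longrightarrow> rng G x = x"
  by (auto simp: units_def rng_rng)

lemma src_of_unit: "x \<in> units G \<Longrightarrow> src G x = x"
  by (auto simp: units_def src_rng)

lemma rng_in_units: "g \<in> arrows G \<Longrightarrow> rng G g \<in> units G"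
  by (simp add: units_def)

lemma unit_in_src_fibre: "x \<in> units G \<Longrightarrow> x \<in> src_fibre G x"
  by (simp add: src_fibre_def units_arrows src_of_unit)

lemma ginv_gmult_cancel:
  assumes "a \<in> arrows G" "b \<in> arrows G" "src G a = rng G b"
  shows "gmult G (ginv G a) (gmult G a b) = b"
  using assms gmult_assoc[of "ginv G a" a b]
  by (simp add: composable_def ginv_closed src_ginv ginv_gmult rng_unit)

lemma gmult_ginv_cancel_right:
  assumes "a \<in> arrows G" "b \<in> arrows G" "src G a = rng G b"
  shows "gmult G (gmult G a b) (ginv G b) = a"
  using assms gmult_assoc[of a b "ginv G b"] src_unit[of a]
  by (simp add: composable_def ginv_closed rng_ginv gmult_ginv)

lemma ginv_gmult_cancel_right:
  assumes "a \<in> arrows G" "b \<in> arrows G" "src G a = src G b"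
  shows "gmult G (gmult G a (ginv G b)) b = a"
  using assms gmult_assoc[of a "ginv G b" b] src_unit[of a]
  by (simp add: composable_def ginv_closed rng_ginv src_ginv ginv_gmult)

lemma ginv_ginv:
  assumes "a \<in> arrows G"
  shows "ginv G (ginv G a) = a"
proof -
  have "gmult G (ginv G (ginv G a)) (gmult G (ginv G a) a) = a"
    using assms by (intro ginv_gmult_cancel) (simp_all add: ginv_closed src_ginv)
  then show ?thesis
    using assms src_unit[of "ginv G (ginv G a)"]
    by (simp add: ginv_gmult ginv_closed src_ginv rng_ginv)
qed

lemma gmult_ginv_closed:
  assumes "g \<in> src_fibre G x" "h \<in> src_fibre G x"
  shows "gmult G g (ginv G h) \<in> arrows G" "rng G (gmult G g (ginv G h)) = rng G g"
    "src G (gmult G g (ginv G h)) = rng G h"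
  using assms by (simp_all add: src_fibre_def composable_def ginv_closed rng_ginv src_ginv
      gmult_closed rng_gmult src_gmult)

text \<open>With k = g h^-1 one has k h = g, so k^-1 g = h; multiplying by g^-1 on the right gives
  the formula.\<close>

lemma ginv_gmult_ginv:
  assumes "g \<in> src_fibre G x" "h \<in> src_fibre G x"
  shows "ginv G (gmult G g (ginv G h)) = gmult G h (ginv G g)"
proof -
  let ?k = "gmult G g (ginv G h)"
  have gh: "g \<in> arrows G" "h \<in> arrows G" "src G g = x" "src G h = x"
    using assms by (auto simp: src_fibre_def)
  note k = gmult_ginv_closed[OF assms]
  have "gmult G (ginv G ?k) (gmult G ?k h) = h"
    using k gh by (intro ginv_gmult_cancel) auto
  then have "gmult G (ginv G ?k) g = h"
    using gh by (simp add: ginv_gmult_cancel_right)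
  moreover have "gmult G (gmult G (ginv G ?k) g) (ginv G g) = ginv G ?k"
    using k gh by (intro gmult_ginv_cancel_right) (auto simp: ginv_closed src_ginv)
  ultimately show ?thesis
    by simp
qed

text \<open>A column of the kernel f(g h^-1), with h fixed, lists the values of f on the source
  fibre of \<open>rng G h\<close>. This reindexing turns column sums into fibre sums.\<close>

lemma bij_betw_gmult_ginv_src:
  assumes "h \<in> src_fibre G x"
  shows "bij_betw (\<lambda>g. gmult G g (ginv G h)) (src_fibre G x) (src_fibre G (rng G h))"
  using assms gmult_ginv_closed
  by (intro bij_betw_byWitness[where f' = "\<lambda>k. gmult G k h"])
    (auto simp: src_fibre_def ginv_gmult_cancel_right gmult_ginv_cancel_right composable_def
      gmult_closed src_gmult)

text \<open>A row of the kernel, with g fixed, lists the values of f on a range fibre; the inverse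
  map sends k to k^-1 g. Besides bounding row sums, this produces the sum in \<open>Psi\<close> when
  the kernel is applied to a constant function.\<close>

lemma bij_betw_gmult_ginv_rng:
  assumes g: "g \<in> src_fibre G x"
  shows "bij_betw (\<lambda>h. gmult G g (ginv G h)) (src_fibre G x) (rng_fibre G (rng G g))"
proof (rule bij_betw_byWitness[where f' = "\<lambda>k. gmult G (ginv G k) g"])
  show "\<forall>h\<in>src_fibre G x. gmult G (ginv G (gmult G g (ginv G h))) g = h"
    using g by (auto simp: ginv_gmult_ginv[OF g]) (auto simp: src_fibre_def ginv_gmult_cancel_right)
  show "\<forall>k\<in>rng_fibre G (rng G g). gmult G g (ginv G (gmult G (ginv G k) g)) = k"
  proof
    fix k assume k: "k \<in> rng_fibre G (rng G g)"
    let ?h = "gmult G (ginv G k) g"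
    have "gmult G ?h (ginv G g) = ginv G k"
      using g k
      by (intro gmult_ginv_cancel_right) (auto simp: src_fibre_def rng_fibre_def ginv_closed src_ginv)
    moreover have "?h \<in> src_fibre G x"
      using g k by (auto simp: src_fibre_def rng_fibre_def composable_def ginv_closed src_ginv
          gmult_closed src_gmult)
    ultimately show "gmult G g (ginv G ?h) = k"
      using ginv_gmult_ginv[of ?h x g] g k ginv_ginv by (simp add: rng_fibre_def)
  qed
qed (use g gmult_ginv_closed in \<open>auto simp: src_fibre_def rng_fibre_def composable_def ginv_closed
    src_ginv gmult_closed src_gmult\<close>)

text \<open>If g h^-1 is a unit, it is \<open>rng G h\<close>, and multiplying by h gives g = h.
  Functions supported on the units therefore have a diagonal kernel.\<close>

lemma gmult_ginv_unit_iff: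
  assumes "g \<in> src_fibre G x" "h \<in> src_fibre G x"
  shows "gmult G g (ginv G h) \<in> units G \<longleftrightarrow> g = h"
proof
  assume u: "gmult G g (ginv G h) \<in> units G"
  have "gmult G g (ginv G h) = rng G h"
    using gmult_ginv_closed(3)[OF assms] src_of_unit[OF u] by simp
  moreover have "gmult G (gmult G g (ginv G h)) h = g"
    using assms by (intro ginv_gmult_cancel_right) (auto simp: src_fibre_def)
  ultimately show "g = h"
    using assms by (simp add: rng_unit src_fibre_def)
qed (use assms in \<open>simp add: src_fibre_def gmult_ginv rng_in_units\<close>)

end

section \<open>Bump functions and closure properties of \<open>Cc\<close>\<close>

lemma locally_compact_Hausdorff_bump:
  assumes X: "locally_compact_space X" "Hausdorff_space X" and U: "openin X U" "x \<in> U"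
  obtains \<phi> :: "'a \<Rightarrow> real" and K
  where "continuous_map X euclidean \<phi>" "\<phi> x = 1" "compactin X K" "K \<subseteq> U"
    "\<And>y. y \<in> topspace X \<Longrightarrow> \<phi> y \<noteq> 0 \<Longrightarrow> y \<in> K"
proof -
  have "neighbourhood_base_of (compactin X) X"
    using X locally_compact_imp_neighbourhood_base locally_compact_Hausdorff_imp_regular_space
    by blast
  then have "\<exists>V K. openin X V \<and> compactin X K \<and> x \<in> V \<and> V \<subseteq> K \<and> K \<subseteq> U"
    using U by (simp add: neighbourhood_base_of)
  then obtain V K where V: "openin X V" "compactin X K" "x \<in> V" "V \<subseteq> K" "K \<subseteq> U"
    by blast
  have "closedin X (topspace X - V)" "x \<in> topspace X - (topspace X - V)"
    using V openin_subset[OF V(1)] by auto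
  moreover have "completely_regular_space X"
    using X locally_compact_regular_imp_completely_regular_space by blast
  ultimately obtain \<psi> :: "'a \<Rightarrow> real" where \<psi>: "continuous_map X (top_of_set {0..1}) \<psi>"
    "\<psi> x = 0" "\<psi> ` (topspace X - V) \<subseteq> {1}"
    unfolding completely_regular_space_def by blast
  \<comment> \<open>The Urysohn function is 0 at x and 1 off V, so its complement is 1 at x and
    nonzero only on V, hence only on the compact set K.\<close>
  then have "continuous_map X euclidean (\<lambda>y. 1 - \<psi> y)"
    by (intro continuous_intros) (auto simp: continuous_map_in_subtopology)
  then show thesis
    using that[of "\<lambda>y. 1 - \<psi> y" K] \<psi> V by force
qed

lemma Cc_bump:
  assumes "locally_compact_space (gtop G)" "Hausdorff_space (gtop G)"
    and U: "openin (gtop G) U" "g \<in> U"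
  obtains f where "f \<in> Cc G" "f g = 1" "\<And>h. f h \<noteq> 0 \<Longrightarrow> h \<in> U"
proof -
  obtain \<phi> :: "_ \<Rightarrow> real" and K where \<phi>: "continuous_map (gtop G) euclidean \<phi>" "\<phi> g = 1"
    "compactin (gtop G) K" "K \<subseteq> U" "\<And>h. h \<in> topspace (gtop G) \<Longrightarrow> \<phi> h \<noteq> 0 \<Longrightarrow> h \<in> K"
    using locally_compact_Hausdorff_bump[OF assms] by blast
  define f where "f h = (if h \<in> arrows G then complex_of_real (\<phi> h) else 0)" for h
  have "continuous_map (gtop G) euclidean (complex_of_real \<circ> \<phi>)"
    by (intro continuous_map_compose[OF \<phi>(1)])
      (simp add: continuous_on_of_real_id)
  then have cont: "continuous_map (gtop G) euclidean f"
    by (rule continuous_map_eq) (simp add: f_def arrows_def)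
  \<comment> \<open>K is closed because the space is Hausdorff, so taking the closure does not leave
    it.\<close>
  have "gtop G closure_of {h \<in> arrows G. f h \<noteq> 0} \<subseteq> K"
    using \<phi>(5) compactin_imp_closedin[OF assms(2) \<phi>(3)]
    by (intro closure_of_minimal) (auto simp: f_def arrows_def)
  then have "compactin (gtop G) (gtop G closure_of {h \<in> arrows G. f h \<noteq> 0})"
    using closed_compactin[OF \<phi>(3)] by simp
  with cont have "f \<in> Cc G"
    by (simp add: Cc_def f_def)
  moreover have "f g = 1"
    using \<phi>(2) U openin_subset by (force simp: f_def arrows_def)
  moreover have "h \<in> U" if "f h \<noteq> 0" for h
    using that \<phi>(4,5) by (auto simp: f_def arrows_def split: if_splits)
  ultimately show thesis
    using that by blast
qed

lemma Cc_add:
  assumes "f \<in> Cc G" "h \<in> Cc G"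
  shows "(\<lambda>g. f g + h g) \<in> Cc G"
proof -
  let ?supp = "\<lambda>f. gtop G closure_of {g \<in> arrows G. f g \<noteq> 0}"
  have "?supp (\<lambda>g. f g + h g) \<subseteq> gtop G closure_of
      ({g \<in> arrows G. f g \<noteq> 0} \<union> {g \<in> arrows G. h g \<noteq> 0})"
    by (rule closure_of_mono) auto
  then have "?supp (\<lambda>g. f g + h g) \<subseteq> ?supp f \<union> ?supp h"
    by simp
  then have "compactin (gtop G) (?supp (\<lambda>g. f g + h g))"
    using assms closed_compactin[OF compactin_Un, of "gtop G" "?supp f" "?supp h"]
    by (simp add: Cc_def)
  then show ?thesis
    using assms by (auto simp: Cc_def intro!: continuous_map_add)
qed

lemma Cc_minus: "f \<in> Cc G \<Longrightarrow> (\<lambda>g. - f g) \<in> Cc G"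
  by (simp add: Cc_def)

lemma open_bisection_inj:
  assumes "open_bisection G U"
  shows "inj_on (rng G) U" "inj_on (src G) U"
proof -
  have "topspace (subtopology (gtop G) U) = U"
    using assms openin_subset by (auto simp: open_bisection_def)
  then show "inj_on (rng G) U" "inj_on (src G) U"
    using assms homeomorphic_imp_injective_map unfolding open_bisection_def by metis+
qed

section \<open>Uniform bounds along the fibres and boundedness of the regular
  representations\<close>

context etale_groupoid
begin

text \<open>Finitely many open bisections cover the compact support, and each meets a fibre of t at
  most once. So every fibre carries at most as many nonzero values of f as there are bisections in
  the cover. The map t stands for either \<open>rng G\<close> or \<open>src G\<close>.\<close>

lemma Cc_fibre_bound:
  assumes f: "f \<in> Cc G" and t: "\<And>U. open_bisection G U \<Longrightarrow> inj_on t U"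
  obtains M where "\<And>x. finite {g \<in> arrows G. t g = x \<and> f g \<noteq> 0}"
    "\<And>x F. F \<subseteq> {g \<in> arrows G. t g = x} \<Longrightarrow> finite F \<Longrightarrow> (\<Sum>g\<in>F. cmod (f g)) \<le> M"
proof -
  let ?S = "{g \<in> arrows G. f g \<noteq> 0}"
  let ?K = "gtop G closure_of ?S"
  have K: "compactin (gtop G) ?K" and cont: "continuous_map (gtop G) euclidean f"
    using f by (auto simp: Cc_def)
  have "compact (f ` ?K)"
    using image_compactin[OF K cont] by simp
  then obtain B where B: "\<And>g. g \<in> ?K \<Longrightarrow> cmod (f g) \<le> B"
    by (meson bounded_iff compact_imp_bounded imageI)
  have SK: "?S \<subseteq> ?K"
    by (intro closure_of_subset) (auto simp: arrows_def)
  have "?K \<subseteq> \<Union>{U. open_bisection G U}"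
    using bisection_basis[OF openin_topspace] closure_of_subset_topspace[of "gtop G" ?S] by blast
  then obtain \<U> where \<U>: "finite \<U>" "\<U> \<subseteq> {U. open_bisection G U}" "?K \<subseteq> \<Union>\<U>"
    using compactinD[OF K, of "{U. open_bisection G U}"] by (auto simp: open_bisection_def)
  have small: "finite {g \<in> U. t g = x} \<and> card {g \<in> U. t g = x} \<le> 1" if "U \<in> \<U>" for U x
  proof -
    have "inj_on t U"
      using \<U>(2) that t by auto
    then have "{g \<in> U. t g = x} \<subseteq> {inv_into U t x}"
      by auto
    then show ?thesis
      using finite_subset[of _ "{inv_into U t x}"] card_mono[of "{inv_into U t x}"] by simp
  qed
  have sub: "{g \<in> arrows G. t g = x \<and> f g \<noteq> 0} \<subseteq> (\<Union>U\<in>\<U>. {g \<in> U. t g = x})" for x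
    using SK \<U>(3) by auto
  have fin: "finite (\<Union>U\<in>\<U>. {g \<in> U. t g = x})" for x
    using small \<U>(1) by auto
  have card: "card {g \<in> arrows G. t g = x \<and> f g \<noteq> 0} \<le> card \<U>" for x
  proof -
    have "card {g \<in> arrows G. t g = x \<and> f g \<noteq> 0} \<le> card (\<Union>U\<in>\<U>. {g \<in> U. t g = x})"
      by (rule card_mono[OF fin sub])
    also have "\<dots> \<le> (\<Sum>U\<in>\<U>. card {g \<in> U. t g = x})"
      by (rule card_UN_le[OF \<U>(1)])
    also have "\<dots> \<le> card \<U>"
      using small sum_bounded_above[of \<U> "\<lambda>U. card {g \<in> U. t g = x}" 1] by simp
    finally show ?thesis .
  qed
  show thesis
  proof (rule that)
    show fin': "finite {g \<in> arrows G. t g = x \<and> f g \<noteq> 0}" for x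
      using finite_subset[OF sub fin] .
    fix x F assume F: "F \<subseteq> {g \<in> arrows G. t g = x}" "finite F"
    have "(\<Sum>g\<in>F. cmod (f g)) = (\<Sum>g\<in>{g \<in> F. f g \<noteq> 0}. cmod (f g))"
      using F by (intro sum.mono_neutral_right) auto
    also have "\<dots> \<le> (\<Sum>g\<in>{g \<in> arrows G. t g = x \<and> f g \<noteq> 0}. cmod (f g))"
      using F fin' by (intro sum_mono2) auto
    \<comment> \<open>If the support is empty, \<open>B\<close> may be negative, hence its absolute
      value.\<close>
    also have "\<dots> \<le> of_nat (card {g \<in> arrows G. t g = x \<and> f g \<noteq> 0}) * \<bar>B\<bar>"
      using B SK by (intro sum_bounded_above) (force intro: order_trans[OF _ abs_ge_self])
    also have "\<dots> \<le> card \<U> * \<bar>B\<bar>"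
      using card by (intro mult_right_mono) auto
    finally show "(\<Sum>g\<in>F. cmod (f g)) \<le> card \<U> * \<bar>B\<bar>" .
  qed
qed

lemma finite_kernel_row:
  assumes f: "f \<in> Cc G" and g: "g \<in> src_fibre G x"
  shows "finite {h \<in> src_fibre G x. f (gmult G g (ginv G h)) \<noteq> 0}"
proof (rule finite_imageD)
  note bij = bij_betw_gmult_ginv_rng[OF g]
  let ?A = "{h \<in> src_fibre G x. f (gmult G g (ginv G h)) \<noteq> 0}"
  have fin: "finite {k \<in> arrows G. rng G k = rng G g \<and> f k \<noteq> 0}"
    using Cc_fibre_bound[OF f open_bisection_inj(1)] by blast
  show "inj_on (\<lambda>h. gmult G g (ginv G h)) ?A"
    by (rule inj_on_subset[OF bij_betw_imp_inj_on[OF bij]]) auto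
  show "finite ((\<lambda>h. gmult G g (ginv G h)) ` ?A)"
    using bij_betw_imp_surj_on[OF bij] by (intro finite_subset[OF _ fin]) (auto simp: rng_fibre_def)
qed

text \<open>Schur's test for the kernel f(g h^-1). The bound does not depend on x, which is what
  places \<open>regular_reps G f\<close> among the uniformly bounded families.\<close>

lemma regular_rep_bounded:
  assumes f: "f \<in> Cc G"
  obtains M where "0 \<le> M"
    "\<And>x. regular_rep G x f \<in> carrier (bounded_ops (ell2 (src_fibre G x)))"
    "\<And>x. anorm (bounded_ops (ell2 (src_fibre G x))) (regular_rep G x f) \<le> M"
proof -
  obtain M1 where "\<And>x. finite {g \<in> arrows G. rng G g = x \<and> f g \<noteq> 0}"
    and M1: "\<And>x F. F \<subseteq> {g \<in> arrows G. rng G g = x} \<Longrightarrow> finite F \<Longrightarrow> (\<Sum>g\<in>F. cmod (f g)) \<le> M1"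
    using Cc_fibre_bound[OF f open_bisection_inj(1)] by blast
  obtain M2 where "\<And>x. finite {g \<in> arrows G. src G g = x \<and> f g \<noteq> 0}"
    and M2: "\<And>x F. F \<subseteq> {g \<in> arrows G. src G g = x} \<Longrightarrow> finite F \<Longrightarrow> (\<Sum>g\<in>F. cmod (f g)) \<le> M2"
    using Cc_fibre_bound[OF f open_bisection_inj(2)] by blast
  \<comment> \<open>Row sums are controlled along range fibres, column sums along source
    fibres.\<close>
  define M where "M = max M1 M2"
  have M: "0 \<le> M"
    using M1[of "{}"] by (simp add: M_def)
  let ?k = "\<lambda>g h. f (gmult G g (ginv G h))"
  have k_row: "(\<Sum>h\<in>F. cmod (?k g h)) \<le> M"
    if "g \<in> src_fibre G x" "finite F" "F \<subseteq> src_fibre G x" for g x F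
  proof -
    note bij = bij_betw_gmult_ginv_rng[OF that(1)]
    have "inj_on (\<lambda>h. gmult G g (ginv G h)) F"
      using that(3) bij_betw_imp_inj_on[OF bij] inj_on_subset by blast
    then have "(\<Sum>h\<in>F. cmod (?k g h)) = (\<Sum>h\<in>(\<lambda>h. gmult G g (ginv G h)) ` F. cmod (f h))"
      by (simp add: sum.reindex)
    also have "\<dots> \<le> M1"
      using that bij_betw_imp_surj_on[OF bij] by (intro M1[of _ "rng G g"]) (auto simp: rng_fibre_def)
    finally show ?thesis
      by (simp add: M_def)
  qed
  have k_col: "(\<Sum>g\<in>F. cmod (?k g h)) \<le> M"
    if "h \<in> src_fibre G x" "finite F" "F \<subseteq> src_fibre G x" for h x F
  proof -
    note bij = bij_betw_gmult_ginv_src[OF that(1)]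
    have "inj_on (\<lambda>g. gmult G g (ginv G h)) F"
      using that(3) bij_betw_imp_inj_on[OF bij] inj_on_subset by blast
    then have "(\<Sum>g\<in>F. cmod (?k g h)) = (\<Sum>g\<in>(\<lambda>g. gmult G g (ginv G h)) ` F. cmod (f g))"
      by (simp add: sum.reindex)
    also have "\<dots> \<le> M2"
      using that bij_betw_imp_surj_on[OF bij] by (intro M2[of _ "rng G h"]) (auto simp: src_fibre_def)
    finally show ?thesis
      by (simp add: M_def)
  qed
  show thesis
  proof (rule that[OF M])
    fix x
    note * = schur_test[of "src_fibre G x" ?k M, OF finite_kernel_row[OF f] k_row k_col M]
    show "regular_rep G x f \<in> carrier (bounded_ops (ell2 (src_fibre G x)))"
      unfolding regular_rep_def by (rule *(1))
    show "anorm (bounded_ops (ell2 (src_fibre G x))) (regular_rep G x f) \<le> M"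
      unfolding regular_rep_def by (rule *(2))
  qed
qed

lemma regular_rep_summable:
  assumes "f \<in> Cc G" "g \<in> src_fibre G x"
  shows "(\<lambda>h. f (gmult G g (ginv G h)) * \<xi> h) summable_on src_fibre G x"
  by (intro infsum_finite_support(1)[OF finite_kernel_row[OF assms]]) auto

end


section \<open>The reduced algebra\<close>

abbreviation regular_prod :: "'g groupoid \<Rightarrow> 'g op_family normed_star_alg" where
  "regular_prod G \<equiv> linf_prod (units G) (\<lambda>x. bounded_ops (ell2 (src_fibre G x)))"

lemma reduced_cstar_simps:
  "(a \<oplus>\<^bsub>reduced_cstar G\<^esub> b) =
    (\<lambda>x\<in>units G. \<lambda>\<xi>\<in>carrier (ell2 (src_fibre G x)). \<lambda>i. a x \<xi> i + b x \<xi> i)"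
  "(a \<oplus>\<^bsub>regular_prod G\<^esub> b) = (a \<oplus>\<^bsub>reduced_cstar G\<^esub> b)"
  "(c \<odot>\<^bsub>reduced_cstar G\<^esub> a) =
    (\<lambda>x\<in>units G. \<lambda>\<xi>\<in>carrier (ell2 (src_fibre G x)). \<lambda>i. c * a x \<xi> i)"
  "(c \<odot>\<^bsub>regular_prod G\<^esub> a) = (c \<odot>\<^bsub>reduced_cstar G\<^esub> a)"
  "\<zero>\<^bsub>reduced_cstar G\<^esub> = (\<lambda>x\<in>units G. \<lambda>\<xi>\<in>carrier (ell2 (src_fibre G x)). \<lambda>i. 0)"
  "anorm (reduced_cstar G) = anorm (regular_prod G)"
  by (simp_all add: reduced_cstar_def linf_prod_def bounded_ops_def ell2_simps Let_def)

lemma reduced_cstar_carrier_iff: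
  "a \<in> carrier (reduced_cstar G) \<longleftrightarrow> a \<in> carrier (regular_prod G) \<and>
    (\<forall>\<epsilon>>0. \<exists>f\<in>Cc G. anorm (regular_prod G)
      (a \<oplus>\<^bsub>reduced_cstar G\<^esub> (-1) \<odot>\<^bsub>reduced_cstar G\<^esub> regular_reps G f) < \<epsilon>)"
  by (simp add: reduced_cstar_def Let_def)

lemma regular_prod_carrier_component:
  assumes "a \<in> carrier (regular_prod G)" "x \<in> units G"
  shows "a x \<in> carrier (bounded_ops (ell2 (src_fibre G x)))"
  using assms by (auto simp: linf_prod_def)

text \<open>Families and their components are both extensional, so an element is determined by the
  vectors \<open>a x \<xi>\<close>. This is how vanishing of \<open>p\<close> is reduced to
  vanishing of all \<open>p x \<xi>\<close>.\<close>

lemma regular_prod_carrier_ext: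
  assumes "a \<in> carrier (regular_prod G)"
  shows "a = (\<lambda>x\<in>units G. \<lambda>\<xi>\<in>carrier (ell2 (src_fibre G x)). a x \<xi>)"
proof -
  have "restrict (a x) (carrier (ell2 (src_fibre G x))) = a x" if "x \<in> units G" for x
    using regular_prod_carrier_component[OF assms that]
    unfolding bounded_ops_ell2_carrier_iff by (elim conjE) (rule PiE_restrict)
  moreover have "restrict a (units G) = a"
    using assms by (auto simp: linf_prod_def intro!: PiE_restrict)
  ultimately show ?thesis
    by (metis (no_types, lifting) restrict_ext)
qed

lemma anorm_regular_prod_le:
  assumes "\<And>x. x \<in> units G \<Longrightarrow> anorm (bounded_ops (ell2 (src_fibre G x))) (a x) \<le> C" "0 \<le> C"
  shows "anorm (regular_prod G) a \<le> C"
  using assms by (auto simp: linf_prod_def intro!: cSup_least)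

lemma regular_prod_add_closed:
  assumes a: "a \<in> carrier (regular_prod G)" and b: "b \<in> carrier (regular_prod G)"
  shows "a \<oplus>\<^bsub>regular_prod G\<^esub> b \<in> carrier (regular_prod G)"
proof -
  obtain C D where
    "\<forall>x\<in>units G. anorm (bounded_ops (ell2 (src_fibre G x))) (a x) \<le> C"
    "\<forall>x\<in>units G. anorm (bounded_ops (ell2 (src_fibre G x))) (b x) \<le> D"
    using a b unfolding linf_prod_def by auto
  then have "anorm (bounded_ops (ell2 (src_fibre G x)))
      (a x \<oplus>\<^bsub>bounded_ops (ell2 (src_fibre G x))\<^esub> b x) \<le> C + D" if "x \<in> units G" for x
    using that regular_prod_carrier_component[OF a that] regular_prod_carrier_component[OF b that]
    by (meson add_mono bounded_ops_ell2_add(2) order_trans)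
  moreover have "a x \<oplus>\<^bsub>bounded_ops (ell2 (src_fibre G x))\<^esub> b x \<in>
      carrier (bounded_ops (ell2 (src_fibre G x)))" if "x \<in> units G" for x
    using that a b by (intro bounded_ops_ell2_add(1) regular_prod_carrier_component)
  ultimately show ?thesis
    by (auto simp: linf_prod_def)
qed

context etale_groupoid
begin

lemma regular_reps_closed:
  assumes "f \<in> Cc G"
  shows "regular_reps G f \<in> carrier (regular_prod G)"
proof -
  obtain M where "0 \<le> M" "\<And>x. regular_rep G x f \<in> carrier (bounded_ops (ell2 (src_fibre G x)))"
    "\<And>x. anorm (bounded_ops (ell2 (src_fibre G x))) (regular_rep G x f) \<le> M"
    using regular_rep_bounded[OF assms] by blast
  then show ?thesis
    by (auto simp: linf_prod_def regular_reps_def)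
qed

lemma regular_reps_apply:
  assumes "x \<in> units G" "\<xi> \<in> carrier (ell2 (src_fibre G x))"
  shows "regular_reps G f x \<xi> = (\<lambda>g. if g \<in> src_fibre G x
    then \<Sum>\<^sub>\<infinity>h\<in>src_fibre G x. f (gmult G g (ginv G h)) * \<xi> h else 0)"
  using assms by (simp add: regular_reps_def regular_rep_def)

lemma regular_reps_add:
  assumes "f \<in> Cc G" "h \<in> Cc G" "x \<in> units G" "\<xi> \<in> carrier (ell2 (src_fibre G x))"
  shows "regular_reps G (\<lambda>g. f g + h g) x \<xi> i = regular_reps G f x \<xi> i + regular_reps G h x \<xi> i"
  using assms by (simp add: regular_reps_apply distrib_right infsum_add regular_rep_summable)

lemma regular_reps_minus:
  assumes "x \<in> units G" "\<xi> \<in> carrier (ell2 (src_fibre G x))"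
  shows "regular_reps G (\<lambda>g. - f g) x \<xi> i = - regular_reps G f x \<xi> i"
  using assms by (simp add: regular_reps_apply infsum_uminus)

text \<open>Turns the difference in the definition of the closure into a sum with an element of the
  image of \<open>Cc G\<close>, to which additivity of E applies.\<close>

lemma minus_regular_reps:
  "(-1) \<odot>\<^bsub>reduced_cstar G\<^esub> regular_reps G f = regular_reps G (\<lambda>g. - f g)"
proof -
  have "regular_reps G (\<lambda>g. - f g) =
      (\<lambda>x\<in>units G. \<lambda>\<xi>\<in>carrier (ell2 (src_fibre G x)). regular_reps G (\<lambda>g. - f g) x \<xi>)"
    by (auto simp: regular_reps_def regular_rep_def restrict_def fun_eq_iff)
  also have "\<dots> = (-1) \<odot>\<^bsub>reduced_cstar G\<^esub> regular_reps G f"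
    unfolding reduced_cstar_simps
    by (intro restrict_ext ext) (simp add: regular_reps_minus)
  finally show ?thesis
    by simp
qed

lemma regular_reps_in_reduced_cstar:
  assumes "f \<in> Cc G"
  shows "regular_reps G f \<in> carrier (reduced_cstar G)"
proof -
  have "anorm (regular_prod G)
      (regular_reps G f \<oplus>\<^bsub>reduced_cstar G\<^esub> (-1) \<odot>\<^bsub>reduced_cstar G\<^esub> regular_reps G f) \<le> 0"
  proof (intro anorm_regular_prod_le anorm_bounded_ops_le)
    fix x and \<xi> :: "'a \<Rightarrow> complex"
    assume "x \<in> units G" "\<xi> \<in> carrier (ell2 (src_fibre G x))"
    then show "hnorm (ell2 (src_fibre G x)) ((regular_reps G f \<oplus>\<^bsub>reduced_cstar G\<^esub>
        (-1) \<odot>\<^bsub>reduced_cstar G\<^esub> regular_reps G f) x \<xi>) \<le> 0"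
      by (simp add: reduced_cstar_simps(1,3) hnorm_def ell2_simps)
  qed simp
  then show ?thesis
    unfolding reduced_cstar_carrier_iff using regular_reps_closed[OF assms] assms
    by (meson le_less_trans)
qed

text \<open>The error of an approximation from \<open>Cc G\<close> must lie in the carrier before
  contractivity of E can be applied to it.\<close>

lemma reduced_cstar_add_regular_reps:
  assumes a: "a \<in> carrier (reduced_cstar G)" and f: "f \<in> Cc G"
  shows "a \<oplus>\<^bsub>reduced_cstar G\<^esub> regular_reps G f \<in> carrier (reduced_cstar G)"
  unfolding reduced_cstar_carrier_iff
proof (intro conjI allI impI)
  have a': "a \<in> carrier (regular_prod G)"
    using a by (simp add: reduced_cstar_carrier_iff)
  then show "a \<oplus>\<^bsub>reduced_cstar G\<^esub> regular_reps G f \<in> carrier (regular_prod G)"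
    using regular_prod_add_closed[OF _ regular_reps_closed[OF f]] by (simp add: reduced_cstar_simps(2))
  fix \<epsilon> :: real assume "0 < \<epsilon>"
  then obtain h where h: "h \<in> Cc G" "anorm (regular_prod G)
      (a \<oplus>\<^bsub>reduced_cstar G\<^esub> (-1) \<odot>\<^bsub>reduced_cstar G\<^esub> regular_reps G h) < \<epsilon>"
    using a by (auto simp: reduced_cstar_carrier_iff)
  \<comment> \<open>If h approximates a, then h + f approximates a + f with the very same
    error.\<close>
  have "a \<oplus>\<^bsub>reduced_cstar G\<^esub> regular_reps G f \<oplus>\<^bsub>reduced_cstar G\<^esub>
      (-1) \<odot>\<^bsub>reduced_cstar G\<^esub> regular_reps G (\<lambda>g. h g + f g) =
    a \<oplus>\<^bsub>reduced_cstar G\<^esub> (-1) \<odot>\<^bsub>reduced_cstar G\<^esub> regular_reps G h"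
    unfolding reduced_cstar_simps(1,3)
    by (intro restrict_ext ext) (simp add: regular_reps_add h f)
  with h Cc_add[OF h(1) f] show "\<exists>h\<in>Cc G. anorm (regular_prod G)
      (a \<oplus>\<^bsub>reduced_cstar G\<^esub> regular_reps G f \<oplus>\<^bsub>reduced_cstar G\<^esub>
        (-1) \<odot>\<^bsub>reduced_cstar G\<^esub> regular_reps G h) < \<epsilon>"
    by force
qed

end

section \<open>Coordinate vectors, and constant functions on infinite sets\<close>

definition delta :: "'i \<Rightarrow> 'i \<Rightarrow> complex" where
  "delta x = (\<lambda>g. if g = x then 1 else 0)"

lemma delta_ell2:
  assumes "x \<in> I"
  shows "delta x \<in> carrier (ell2 I)" "hnorm (ell2 I) (delta x) \<le> 1"
proof -
  have "(\<Sum>i\<in>F. (cmod (delta x i))\<^sup>2) \<le> 1" if "finite F" for F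
  proof -
    have "(\<Sum>i\<in>F. (cmod (delta x i))\<^sup>2) = (\<Sum>i\<in>F. if i = x then 1 else 0)"
      by (intro sum.cong) (auto simp: delta_def)
    then show ?thesis
      using that by simp
  qed
  then have *: "finite F \<Longrightarrow> L2_set (\<lambda>i. cmod (delta x i)) F \<le> 1" for F
    by (simp add: L2_set_def)
  show "delta x \<in> carrier (ell2 I)" "hnorm (ell2 I) (delta x) \<le> 1"
    using assms * by (auto simp: delta_def intro!: ell2_bounded_L2_set)
qed

text \<open>Any n entries of modulus |c| force the norm to be at least sqrt n * |c|, and an infinite
  set provides such entries for every n.\<close>

lemma ell2_constant_infinite:
  assumes "infinite I" "\<zeta> \<in> carrier (ell2 I)" "\<And>i. i \<in> I \<Longrightarrow> \<zeta> i = c"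
  shows "c = 0"
proof (rule ccontr)
  assume "c \<noteq> 0"
  obtain n :: nat where n: "(hnorm (ell2 I) \<zeta> / cmod c)\<^sup>2 < real n"
    using reals_Archimedean2 by blast
  obtain F where F: "F \<subseteq> I" "finite F" "card F = n"
    using infinite_arbitrarily_large[OF assms(1)] by blast
  have "L2_set (\<lambda>i. cmod (\<zeta> i)) F = L2_set (\<lambda>i. cmod c) F"
    using F assms(3) by (intro L2_set_cong) auto
  then have "sqrt n * cmod c \<le> hnorm (ell2 I) \<zeta>"
    using L2_set_le_ell2_hnorm[OF assms(2) F(2,1)] F(3) by (simp add: L2_set_constant)
  then have "sqrt n \<le> hnorm (ell2 I) \<zeta> / cmod c"
    using \<open>c \<noteq> 0\<close> by (simp add: field_simps)
  then have "real n \<le> (hnorm (ell2 I) \<zeta> / cmod c)\<^sup>2"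
    by (rule sqrt_le_D)
  with n show False
    by simp
qed

section \<open>The expectation as a diagonal entry, and the components of a Kazhdan
  projection\<close>

context etale_groupoid
begin

lemma canonical_expectation_eq:
  assumes E: "canonical_expectation G E" and a: "a \<in> carrier (reduced_cstar G)"
    and x: "x \<in> units G"
  shows "E a x = a x (delta x) x"
proof -
  let ?A = "reduced_cstar G" and ?H = "ell2 (src_fibre G x)"
  note \<delta> = delta_ell2[OF unit_in_src_fibre[OF x]]
  have E_add: "E (a \<oplus>\<^bsub>?A\<^esub> b) x = E a x + E b x"
    and E_bound: "cmod (E a x) \<le> anorm ?A a"
    and E_Cc: "f \<in> Cc G \<Longrightarrow> E (regular_reps G f) x = f x"
    if "a \<in> carrier ?A" "b \<in> carrier ?A" for a b f
    using E that x unfolding canonical_expectation_def Let_def by blast+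
  have "cmod (E a x - a x (delta x) x) < 2 * \<epsilon>" if "0 < \<epsilon>" for \<epsilon>
  proof -
    obtain f where f: "f \<in> Cc G"
      and near: "anorm ?A (a \<oplus>\<^bsub>?A\<^esub> (-1) \<odot>\<^bsub>?A\<^esub> regular_reps G f) < \<epsilon>"
      using a \<open>0 < \<epsilon>\<close> by (auto simp: reduced_cstar_carrier_iff reduced_cstar_simps(6))
    let ?h = "\<lambda>g. - f g"
    define b where "b = a \<oplus>\<^bsub>?A\<^esub> regular_reps G ?h"
    have h: "?h \<in> Cc G"
      by (rule Cc_minus[OF f])
    have b: "b \<in> carrier ?A"
      unfolding b_def by (rule reduced_cstar_add_regular_reps[OF a h])
    have b_near: "anorm ?A b < \<epsilon>"
      using near by (simp add: b_def minus_regular_reps)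
    have "E b x = E a x - f x"
      using E_add[OF a regular_reps_in_reduced_cstar[OF h]]
        E_Cc[OF a a h] by (simp add: b_def)
    moreover have "b x (delta x) x = a x (delta x) x - f x"
    proof -
      \<comment> \<open>Only the term h = x survives, and x x^-1 = x.\<close>
      have "regular_reps G f x (delta x) x = f x"
        using infsum_finite_support(2)[of "{x}" "src_fibre G x"
            "\<lambda>h. f (gmult G x (ginv G h)) * delta x h"] x \<delta>(1)
        by (simp add: regular_reps_apply unit_in_src_fibre delta_def gmult_ginv units_arrows
            rng_of_unit)
      then show ?thesis
        using x \<delta>(1) by (simp add: b_def reduced_cstar_simps(1) regular_reps_minus)
    qed
    \<comment> \<open>The value f(x) cancels, so the discrepancy for a equals the one for the small
      element b.\<close>
    ultimately have "E a x - a x (delta x) x = E b x - b x (delta x) x"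
      by simp
    moreover have "cmod (b x (delta x) x) \<le> anorm ?A b"
    proof -
      have b': "b \<in> carrier (regular_prod G)"
        using b by (simp add: reduced_cstar_carrier_iff)
      note bx = regular_prod_carrier_component[OF b' x]
      have "cmod (b x (delta x) x) \<le> hnorm ?H (b x (delta x))"
        by (rule ell2_cmod_le_hnorm[OF bounded_ops_ell2_closed[OF bx \<delta>(1)]])
      also have "\<dots> \<le> anorm (bounded_ops ?H) (b x)"
        by (rule hnorm_le_anorm_bounded_ops[OF bx \<delta>])
      also have "\<dots> \<le> anorm ?A b"
        using anorm_component_le_linf_prod[OF b' x] by (simp add: reduced_cstar_simps(6))
      finally show ?thesis .
    qed
    ultimately show ?thesis
      using E_bound[OF b b] b_near norm_triangle_ineq4[of "E b x" "b x (delta x) x"] by simp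
  qed
  \<comment> \<open>With epsilon half the discrepancy d, the estimate would read d < d unless d =
    0.\<close>
  from this[of "cmod (E a x - a x (delta x) x) / 2"] show ?thesis
    by fastforce
qed

text \<open>\<open>ell2_total\<close> differs from \<open>ell2\<close> only in its addition, which
  products, adjoints, scalars and the unit do not involve. For sums, \<open>a x \<xi>\<close> and
  \<open>b x \<xi>\<close> lie in the carrier, where both additions agree.\<close>

lemma evaluation_star_hom:
  assumes x: "x \<in> units G"
  shows "unital_star_hom (reduced_cstar G) (bounded_ops (ell2_total (src_fibre G x))) (\<lambda>a. a x)"
proof -
  let ?A = "reduced_cstar G" and ?H = "ell2_total (src_fibre G x)"
  have closed: "a x \<in> carrier (bounded_ops (ell2 (src_fibre G x)))" if "a \<in> carrier ?A" for a
    using that x by (simp add: reduced_cstar_carrier_iff regular_prod_carrier_component)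
  have "(a \<oplus>\<^bsub>?A\<^esub> b) x = a x \<oplus>\<^bsub>bounded_ops ?H\<^esub> b x"
    if "a \<in> carrier ?A" "b \<in> carrier ?A" for a b
  proof -
    have "a x \<oplus>\<^bsub>bounded_ops ?H\<^esub> b x = (\<lambda>\<xi>\<in>carrier ?H. a x \<xi> \<oplus>\<^bsub>?H\<^esub> b x \<xi>)"
      by (simp add: bounded_ops_def)
    also have "\<dots> = (a \<oplus>\<^bsub>?A\<^esub> b) x"
      using x by (simp add: reduced_cstar_simps(1) ell2_total_simps bounded_ops_ell2_closed closed that
          cong: restrict_cong)
    finally show ?thesis
      by simp
  qed
  moreover have "(c \<odot>\<^bsub>?A\<^esub> a) x = c \<odot>\<^bsub>bounded_ops ?H\<^esub> a x" for c a
    using x by (simp add: reduced_cstar_simps bounded_ops_def ell2_total_simps)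
  moreover have "(a \<otimes>\<^bsub>?A\<^esub> b) x = a x \<otimes>\<^bsub>bounded_ops ?H\<^esub> b x"
    "star ?A a x = star (bounded_ops ?H) (a x)" "\<one>\<^bsub>?A\<^esub> x = \<one>\<^bsub>bounded_ops ?H\<^esub>" for a b
    using x
    by (simp_all add: reduced_cstar_def linf_prod_def bounded_ops_def ell2_total_simps Let_def)
  ultimately show ?thesis
    using closed by (simp add: unital_star_hom_def bounded_ops_ell2_total_carrier)
qed

text \<open>\<open>Psi G f\<close> vanishes off the units, and g h^-1 is a unit only for h = g, so
  the kernel is diagonal.\<close>

lemma regular_reps_Psi:
  assumes "x \<in> units G" "\<xi> \<in> carrier (ell2 (src_fibre G x))" "g \<in> src_fibre G x"
  shows "regular_reps G (Psi G f) x \<xi> g = Psi G f (rng G g) * \<xi> g"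
proof -
  have "Psi G f (gmult G g (ginv G h)) = 0" if "h \<in> src_fibre G x - {g}" for h
    using gmult_ginv_unit_iff[of g x h] assms(3) that by (auto simp: Psi_def)
  then have "(\<Sum>\<^sub>\<infinity>h\<in>src_fibre G x. Psi G f (gmult G g (ginv G h)) * \<xi> h) =
      Psi G f (gmult G g (ginv G g)) * \<xi> g"
    using infsum_finite_support(2)[of "{g}" "src_fibre G x"
        "\<lambda>h. Psi G f (gmult G g (ginv G h)) * \<xi> h"] assms(3) by simp
  then show ?thesis
    using assms by (simp add: regular_reps_apply src_fibre_def gmult_ginv)
qed

text \<open>A function f that is 1 at g x^-1 and vanishes off a bisection has no other nonzero value
  on that range fibre. So f produces the entry \<open>\<xi> x\<close> at g, while
  \<open>Psi G f\<close> is 1 at \<open>rng G g\<close> and produces \<open>\<xi> g\<close>.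
  Conversely, on a function with constant value c both actions give c times the sum of f over the
  range fibre.\<close>

lemma constant_vectors_regular:
  assumes top: "locally_compact_space (gtop G)" "Hausdorff_space (gtop G)" and x: "x \<in> units G"
  shows "constant_vectors G (ell2_total (src_fibre G x)) (\<lambda>f. regular_reps G f x) =
    {\<xi> \<in> carrier (ell2 (src_fibre G x)). \<exists>c. \<forall>g\<in>src_fibre G x. \<xi> g = c}"
proof (intro Set.set_eqI iffI)
  let ?H = "ell2 (src_fibre G x)"
  fix \<xi>
  assume "\<xi> \<in> constant_vectors G (ell2_total (src_fibre G x)) (\<lambda>f. regular_reps G f x)"
  then have \<xi>: "\<xi> \<in> carrier ?H"
    and const: "\<And>f. f \<in> Cc G \<Longrightarrow> regular_reps G f x \<xi> = regular_reps G (Psi G f) x \<xi>"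
    by (auto simp: constant_vectors_def ell2_total_simps)
  have "\<xi> g = \<xi> x" if g: "g \<in> src_fibre G x" for g
  proof -
    let ?k = "gmult G g (ginv G x)"
    note xx = unit_in_src_fibre[OF x]
    note k = gmult_ginv_closed[OF g xx]
    obtain U where U: "open_bisection G U" "?k \<in> U"
      using bisection_basis[OF openin_topspace] k(1) unfolding arrows_def by blast
    then obtain f where f: "f \<in> Cc G" "f ?k = 1" "\<And>h. f h \<noteq> 0 \<Longrightarrow> h \<in> U"
      using Cc_bump[OF top, of U ?k] by (auto simp: open_bisection_def)
    have single: "k' = ?k" if "f k' \<noteq> 0" "rng G k' = rng G g" for k'
      using inj_onD[OF open_bisection_inj(1)[OF U(1)], of k' ?k] f(3)[OF that(1)] U(2) k(2) that(2)
      by simp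
    have "f (gmult G g (ginv G h)) = 0" if h: "h \<in> src_fibre G x - {x}" for h
    proof (rule ccontr)
      assume "f (gmult G g (ginv G h)) \<noteq> 0"
      then have "gmult G g (ginv G h) = ?k"
        using single gmult_ginv_closed(2)[of g x h] g h by auto
      then show False
        using bij_betw_imp_inj_on[OF bij_betw_gmult_ginv_rng[OF g]] h xx by (auto dest: inj_onD)
    qed
    then have "regular_reps G f x \<xi> g = \<xi> x"
      using infsum_finite_support(2)[of "{x}" "src_fibre G x"
          "\<lambda>h. f (gmult G g (ginv G h)) * \<xi> h"] xx x \<xi> g f(2)
      by (simp add: regular_reps_apply)
    moreover have "(\<Sum>\<^sub>\<infinity>k\<in>rng_fibre G (rng G g). f k) = f ?k"
    proof -
      have "f k' = 0" if "k' \<in> rng_fibre G (rng G g) - {?k}" for k'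
        using single[of k'] that by (auto simp: rng_fibre_def)
      then show ?thesis
        using infsum_finite_support(2)[of "{?k}" "rng_fibre G (rng G g)" f] k
        by (simp add: rng_fibre_def)
    qed
    then have "Psi G f (rng G g) = 1"
      using g f(2) by (simp add: Psi_def src_fibre_def rng_in_units)
    ultimately show ?thesis
      using const[OF f(1)] regular_reps_Psi[OF x \<xi> g, of f] by simp
  qed
  with \<xi> show "\<xi> \<in> {\<xi> \<in> carrier ?H. \<exists>c. \<forall>g\<in>src_fibre G x. \<xi> g = c}"
    by blast
next
  let ?H = "ell2 (src_fibre G x)"
  fix \<xi>
  assume "\<xi> \<in> {\<xi> \<in> carrier ?H. \<exists>c. \<forall>g\<in>src_fibre G x. \<xi> g = c}"
  then obtain c where \<xi>: "\<xi> \<in> carrier ?H" and c: "\<And>g. g \<in> src_fibre G x \<Longrightarrow> \<xi> g = c"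
    by blast
  have "regular_reps G f x \<xi> g = regular_reps G (Psi G f) x \<xi> g" for f g
  proof (cases "g \<in> src_fibre G x")
    case True
    have "regular_reps G f x \<xi> g = (\<Sum>\<^sub>\<infinity>h\<in>src_fibre G x. f (gmult G g (ginv G h)) * c)"
      using True x \<xi> by (simp add: regular_reps_apply c cong: infsum_cong)
    also have "\<dots> = (\<Sum>\<^sub>\<infinity>k\<in>rng_fibre G (rng G g). f k) * c"
      by (simp add: infsum_cmult_left' infsum_reindex_bij_betw[OF bij_betw_gmult_ginv_rng[OF True]])
    also have "\<dots> = Psi G f (rng G g) * \<xi> g"
      using True by (simp add: Psi_def c src_fibre_def rng_in_units)
    finally show ?thesis
      using regular_reps_Psi[OF x \<xi> True] by simp
  next
    case False
    then show ?thesis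
      using x \<xi> by (simp add: regular_reps_apply)
  qed
  then show "\<xi> \<in> constant_vectors G (ell2_total (src_fibre G x)) (\<lambda>f. regular_reps G f x)"
    using \<xi> by (auto simp: constant_vectors_def ell2_total_simps fun_eq_iff)
qed

text \<open>Vectors over \<open>src_fibre G x\<close> have exactly the type over which
  \<open>kazhdan_projection\<close> quantifies, so evaluation at x is an admissible
  representation.\<close>

lemma kazhdan_projection_component:
  assumes "kazhdan_projection G p" "x \<in> units G"
  shows "is_orthogonal_projection (ell2_total (src_fibre G x))
    (constant_vectors G (ell2_total (src_fibre G x)) (\<lambda>f. regular_reps G f x)) (p x)"
  using assms(1) evaluation_star_hom[OF assms(2)] ell2_total_hilbert_space
  unfolding kazhdan_projection_def Let_def by blast

lemma kazhdan_projection_constant: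
  assumes top: "locally_compact_space (gtop G)" "Hausdorff_space (gtop G)"
    and p: "kazhdan_projection G p" and x: "x \<in> units G" and \<xi>: "\<xi> \<in> carrier (ell2 (src_fibre G x))"
  obtains c where "p x \<xi> \<in> carrier (ell2 (src_fibre G x))" "\<And>g. g \<in> src_fibre G x \<Longrightarrow> p x \<xi> g = c"
proof -
  have "p x \<xi> \<in> constant_vectors G (ell2_total (src_fibre G x)) (\<lambda>f. regular_reps G f x)"
    using kazhdan_projection_component[OF p x] \<xi>
    by (simp add: is_orthogonal_projection_def ell2_total_simps)
  then show thesis
    using that unfolding constant_vectors_regular[OF top x] by blast
qed

lemma kazhdan_projection_infinite:
  assumes top: "locally_compact_space (gtop G)" "Hausdorff_space (gtop G)"
    and p: "kazhdan_projection G p" and x: "x \<in> units G" and \<xi>: "\<xi> \<in> carrier (ell2 (src_fibre G x))"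
    and inf: "infinite (src_fibre G x)"
  shows "p x \<xi> = (\<lambda>g. 0)"
proof -
  obtain c where c: "p x \<xi> \<in> carrier (ell2 (src_fibre G x))"
    "\<And>g. g \<in> src_fibre G x \<Longrightarrow> p x \<xi> g = c"
    using kazhdan_projection_constant[OF top p x \<xi>] by blast
  then have "c = 0"
    by (rule ell2_constant_infinite[OF inf])
  with c show ?thesis
    using ell2_outside[OF c(1)] by (metis ext)
qed

text \<open>The difference between \<open>delta x\<close> and its projection is orthogonal to the
  constant function 1, so the common value c of the projection satisfies |G_x| c = 1.\<close>

lemma kazhdan_projection_delta:
  assumes top: "locally_compact_space (gtop G)" "Hausdorff_space (gtop G)"
    and p: "kazhdan_projection G p" and x: "x \<in> units G" and fin: "finite (src_fibre G x)"
  shows "p x (delta x) x = 1 / of_nat (card (src_fibre G x))"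
proof -
  let ?I = "src_fibre G x"
  note xx = unit_in_src_fibre[OF x]
  note \<delta> = delta_ell2(1)[OF xx]
  obtain c where c: "p x (delta x) \<in> carrier (ell2 ?I)" "\<And>g. g \<in> ?I \<Longrightarrow> p x (delta x) g = c"
    using kazhdan_projection_constant[OF top p x \<delta>] by blast
  \<comment> \<open>Finiteness of the fibre makes this function square-summable, hence a constant
    vector to test against.\<close>
  define \<eta> where "\<eta> = (\<lambda>g. if g \<in> ?I then 1 else 0 :: complex)"
  have "\<eta> \<in> constant_vectors G (ell2_total ?I) (\<lambda>f. regular_reps G f x)"
    using fin unfolding constant_vectors_regular[OF top x] by (auto simp: \<eta>_def ell2_carrier_iff)
  then have "cip (ell2_total ?I) \<eta> (delta x \<ominus>\<^bsub>ell2_total ?I\<^esub> p x (delta x)) = 0"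
    using kazhdan_projection_component[OF p x] \<delta>
    by (simp add: is_orthogonal_projection_def ell2_total_simps)
  then have "(\<Sum>g\<in>?I. delta x g - c) = 0"
    using fin \<delta> c by (simp add: ell2_total_minus ell2_total_simps ell2_simps \<eta>_def)
  moreover have "(\<Sum>g\<in>?I. delta x g) = 1"
    using fin xx by (simp add: delta_def)
  ultimately have "of_nat (card ?I) * c = 1"
    by (simp add: sum_subtractf)
  moreover have "card ?I \<noteq> 0"
    using fin xx by auto
  ultimately show ?thesis
    using c(2)[OF xx] by (simp add: field_simps)
qed

end

theorem proposition7p9:
  fixes G :: "'g groupoid" and p :: "'g op_family"
  assumes "etale_groupoid G"
    and "locally_compact_space (gtop G)"
    and "Hausdorff_space (gtop G)"
    and "compactin (gtop G) (units G)"
    and "kazhdan_projection G p"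
  shows "(\<forall>E. canonical_expectation G E \<longrightarrow>
            {x \<in> units G. E p x > 0} = {x \<in> units G. finite (src_fibre G x)}) \<and>
         (p \<noteq> \<zero>\<^bsub>reduced_cstar G\<^esub> \<longleftrightarrow> (\<exists>x\<in>units G. finite (src_fibre G x)))"
proof -
  interpret etale_groupoid G
    by fact
  note top = assms(2,3) and p = assms(5)
  have p_mem: "p \<in> carrier (reduced_cstar G)"
    using p by (simp add: kazhdan_projection_def Let_def)
  have pos: "0 < p x (delta x) x \<longleftrightarrow> finite (src_fibre G x)" if x: "x \<in> units G" for x
  proof (cases "finite (src_fibre G x)")
    case True
    then have "0 < card (src_fibre G x)"
      using unit_in_src_fibre[OF x] by (auto simp: card_gt_0_iff)
    \<comment> \<open>Written as a real number, the entry can be compared with 0 in the order of the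
      complex numbers, which demands equal imaginary parts.\<close>
    moreover have "p x (delta x) x = complex_of_real (1 / real (card (src_fibre G x)))"
      using kazhdan_projection_delta[OF top p x True] by simp
    ultimately show ?thesis
      using True by (simp add: less_complex_def)
  next
    case False
    then show ?thesis
      using kazhdan_projection_infinite[OF top p x delta_ell2(1)[OF unit_in_src_fibre[OF x]]] by simp
  qed
  have "E p x = p x (delta x) x" if "canonical_expectation G E" "x \<in> units G" for E x
    using canonical_expectation_eq[OF that(1) p_mem that(2)] .
  then have "{x \<in> units G. E p x > 0} = {x \<in> units G. finite (src_fibre G x)}"
    if "canonical_expectation G E" for E
    using that pos by auto
  \<comment> \<open>The criterion for p to be nonzero is independent of any E and is read off from
    the components of p.\<close>
  moreover have "p = \<zero>\<^bsub>reduced_cstar G\<^esub>" if "\<And>x. x \<in> units G \<Longrightarrow> infinite (src_fibre G x)"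
  proof -
    have "p = (\<lambda>x\<in>units G. \<lambda>\<xi>\<in>carrier (ell2 (src_fibre G x)). p x \<xi>)"
      using p_mem by (intro regular_prod_carrier_ext) (simp add: reduced_cstar_carrier_iff)
    also have "\<dots> = \<zero>\<^bsub>reduced_cstar G\<^esub>"
      unfolding reduced_cstar_simps using that
      by (intro restrict_ext) (simp add: kazhdan_projection_infinite[OF top p])
    finally show ?thesis .
  qed
  moreover have "p \<noteq> \<zero>\<^bsub>reduced_cstar G\<^esub>" if x: "x \<in> units G" "finite (src_fibre G x)" for x
  proof
    assume "p = \<zero>\<^bsub>reduced_cstar G\<^esub>"
    then have "p x (delta x) x = 0"
      using x delta_ell2(1)[OF unit_in_src_fibre[OF x(1)]] by (simp add: reduced_cstar_simps(5))
    then show False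
      using pos[OF x(1)] x(2) by simp
  qed
  ultimately show ?thesis
    by blast
qed

end
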